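(* Let $d\ge1$, $\lambda>0$, let $\mathbf{m}=(m_1,\dots,m_d)$ be a fixed multi-index with $m_j\ge1$ for $j=1,\dots,d$, and let $f\in\mathcal{H}^{\mathbf{m}}(\Omega_d)$. Then the multivariate Gegenbauer coefficients $a_{\mathbf{k}}$, $\mathbf{k}\in\mathbb{N}_0^d$, of $f$ satisfy $$|a_{\mathbf{k}}|\le\frac{V_{\mathbf{k},\mathbf{m}}}{h_{\mathbf{k}}^{(\lambda)}}\prod_{j=1}^d\left[\sqrt{h^{(\lambda+\min\{k_j,m_j\})}_{k_j-\min\{k_j,m_j\}}}\ \prod_{s=0}^{\min\{k_j,m_j\}-1}\frac{2(\lambda+s)}{(k_j-s)(k_j+2\lambda+s)}\right],$$ where $$V_{\mathbf{k},\mathbf{m}}=\sqrt{\int_{\Omega_d}\left|(\partial^{\min\{\mathbf{k},\mathbf{m}\}}f)(\mathbf{x})\right|^2\omega_{\lambda+\min\{\mathbf{k},\mathbf{m}\}}(\mathbf{x})\,d\mathbf{x}}$$ and the product over $s$ is taken to be $1$ when its upper limit is negative, i.e. when $\min\{k_j,m_j\}=0$.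
   Context: $\Omega_d=[-1,1]^d$. For multi-indices, $\mathbf{n}\le\mathbf{m}$ is componentwise, $\mathbf{m}-1=(m_1-1,\dots,m_d-1)$, $\min\{\mathbf{k},\mathbf{m}\}=(\min\{k_1,m_1\},\dots,\min\{k_d,m_d\})$, and $\partial^{\mathbf{n}}f=\frac{\partial^{n_1+\dots+n_d}f}{\partial x_1^{n_1}\cdots\partial x_d^{n_d}}$ in the distributional sense. The space is $$\mathcal{H}^{\mathbf{m}}(\Omega_d)=\{f:\ \partial^{\mathbf{n}}f\in C(\Omega_d)\ \text{for } \mathbf{0}\le\mathbf{n}\le\mathbf{m}-1,\ \partial^{\mathbf{m}}f\in L^2(\Omega_d)\}.$$ $C_n^{(\mu)}$ ($\mu>0$) is the Gegenbauer polynomial of degree $n$, orthogonal on $[-1,1]$ with respect to $\omega_\mu(x)=(1-x^2)^{\mu-1/2}$, normalized by $C_n^{(\mu)}(1)=\frac{\Gamma(n+2\mu)}{n!\,\Gamma(2\mu)}$, and $h_n^{(\mu)}=\int_{-1}^1C_n^{(\mu)}(x)^2\omega_\mu(x)\,dx=\frac{2^{1-2\mu}\pi}{\Gamma(\mu)^2}\frac{\Gamma(n+2\mu)}{\Gamma(n+1)(n+\mu)}$. With $C_{\mathbf{k}}^{(\lambda)}(\mathbf{x})=\prod_jC_{k_j}^{(\lambda)}(x_j)$, $h_{\mathbf{k}}^{(\lambda)}=\prod_jh_{k_j}^{(\lambda)}$, $\omega_\lambda(\mathbf{x})=\prod_j\omega_\lambda(x_j)$ and $\omega_{\lambda+\mathbf{n}}(\mathbf{x})=\prod_j\omega_{\lambda+n_j}(x_j)$,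 the multivariate Gegenbauer coefficients are $a_{\mathbf{k}}=\frac1{h_{\mathbf{k}}^{(\lambda)}}\int_{\Omega_d}f(\mathbf{x})C_{\mathbf{k}}^{(\lambda)}(\mathbf{x})\omega_\lambda(\mathbf{x})\,d\mathbf{x}$.
   Formalization: V_{k,m} is taken in [0,∞] and set to ∞ (a trivial bound) when ∂^{min{k,m}}f is not a function or has infinite weighted L² norm; for mixed orders this can happen for f in H^m, e.g. m=(1,1), k=(1,0), f(x,y)=w(x) with w continuous, nowhere differentiable. *)

theory Defs
  imports "HOL-Analysis.Analysis"
begin

section \<open>Gegenbauer polynomials\<close>

definition gegenbauer_weight :: "real \<Rightarrow> real \<Rightarrow> real" where
  "gegenbauer_weight \<mu> x = (1 - x\<^sup>2) powr (\<mu> - 1/2)"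

definition gegenbauer_family :: "real \<Rightarrow> (nat \<Rightarrow> real poly) \<Rightarrow> bool" where
  "gegenbauer_family \<mu> C \<longleftrightarrow>
     (\<forall>n. degree (C n) = n) \<and>
     (\<forall>n k. n \<noteq> k \<longrightarrow>
        (LINT x:{-1..1}|lebesgue. poly (C n) x * poly (C k) x * gegenbauer_weight \<mu> x) = 0) \<and>
     (\<forall>n. poly (C n) 1 = Gamma (real n + 2 * \<mu>) / (fact n * Gamma (2 * \<mu>)))"

text \<open>For \<open>\<mu> > 0\<close> there is exactly one family with these properties.\<close>

definition gegenbauer :: "real \<Rightarrow> nat \<Rightarrow> real poly" where
  "gegenbauer \<mu> = (THE C. gegenbauer_family \<mu> C)"

definition gegenbauer_norm :: "real \<Rightarrow> nat \<Rightarrow> real" where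
  "gegenbauer_norm \<mu> n =
     (LINT x:{-1..1}|lebesgue. (poly (gegenbauer \<mu> n) x)\<^sup>2 * gegenbauer_weight \<mu> x)"


section \<open>Distributional derivatives on the cube\<close>

text \<open>
  The dimension is the cardinality of the finite index type \<open>'n\<close>; multi-indices are functions
  \<open>'n \<Rightarrow> nat\<close> with their componentwise order.
\<close>

definition cube :: "(real ^ 'n) set" where
  "cube = cbox (\<chi> i. -1) (\<chi> i. 1)"

definition partial_deriv :: "'n \<Rightarrow> (real ^ 'n \<Rightarrow> real) \<Rightarrow> real ^ 'n \<Rightarrow> real" where
  "partial_deriv i \<phi> x = deriv (\<lambda>t. \<phi> (x + t *\<^sub>R axis i 1)) 0"

definition iterated_partial :: "'n list \<Rightarrow> (real ^ 'n \<Rightarrow> real) \<Rightarrow> real ^ 'n \<Rightarrow> real" where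
  "iterated_partial is \<phi> = foldr partial_deriv is \<phi>"

text \<open>
  Differentiability of all iterated partial derivatives implies their continuity, so this is
  membership in \<open>C\<^sup>\<infinity>\<close>.
\<close>

definition smooth :: "(real ^ 'n \<Rightarrow> real) \<Rightarrow> bool" where
  "smooth \<phi> \<longleftrightarrow> (\<forall>is. iterated_partial is \<phi> differentiable_on UNIV)"

text \<open>
  The operator \<open>\<partial>\<^sup>n\<close> on smooth functions. An index type carries no canonical order, so some
  enumeration of the directions is chosen; by symmetry of the derivatives of a smooth function
  the result does not depend on it.
\<close>

definition multi_deriv :: "('n \<Rightarrow> nat) \<Rightarrow> (real ^ 'n \<Rightarrow> real) \<Rightarrow> real ^ 'n \<Rightarrow> real" where
  "multi_deriv n \<phi> = iterated_partial (SOME is. \<forall>i. count_list is i = n i) \<phi>"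

definition test_function :: "(real ^ 'n) set \<Rightarrow> (real ^ 'n \<Rightarrow> real) \<Rightarrow> bool" where
  "test_function U \<phi> \<longleftrightarrow>
     smooth \<phi> \<and> (\<exists>K. compact K \<and> K \<subseteq> U \<and> (\<forall>x. x \<notin> K \<longrightarrow> \<phi> x = 0))"

definition locally_integrable :: "(real ^ 'n) set \<Rightarrow> (real ^ 'n \<Rightarrow> real) \<Rightarrow> bool" where
  "locally_integrable U f \<longleftrightarrow>
     (\<forall>K. compact K \<and> K \<subseteq> U \<longrightarrow> set_integrable lebesgue K f)"

text \<open>
  The distribution \<open>\<partial>\<^sup>n f\<close> on the open cube is (represented by) the function \<open>g\<close>.
\<close>

definition has_distr_deriv ::
    "(real ^ 'n \<Rightarrow> real) \<Rightarrow> ('n \<Rightarrow> nat) \<Rightarrow> (real ^ 'n \<Rightarrow> real) \<Rightarrow> bool" where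
  "has_distr_deriv f n g \<longleftrightarrow>
     locally_integrable (interior cube) f \<and>
     locally_integrable (interior cube) g \<and>
     (\<forall>\<phi>. test_function (interior cube) \<phi> \<longrightarrow>
        (LINT x:interior cube|lebesgue. f x * multi_deriv n \<phi> x) =
        (-1) ^ (\<Sum>i\<in>UNIV. n i) * (LINT x:interior cube|lebesgue. g x * \<phi> x))"

text \<open>A representing function is unique up to a null set.\<close>

definition distr_deriv ::
    "('n \<Rightarrow> nat) \<Rightarrow> (real ^ 'n \<Rightarrow> real) \<Rightarrow> real ^ 'n \<Rightarrow> real" where
  "distr_deriv n f = (SOME g. has_distr_deriv f n g)"

definition square_integrable_on :: "(real ^ 'n \<Rightarrow> real) \<Rightarrow> (real ^ 'n) set \<Rightarrow> bool" where
  "square_integrable_on f S \<longleftrightarrow>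
     set_borel_measurable lebesgue S f \<and> set_integrable lebesgue S (\<lambda>x. (f x)\<^sup>2)"

text \<open>
  The space \<open>H\<^sup>m\<close> on the cube, for \<open>m\<close> with all components positive. The condition for the
  multi-index 0 is \<open>f \<in> C\<close>: \<open>f\<close> is taken to be its own continuous representative.
\<close>

definition mixed_space :: "('n \<Rightarrow> nat) \<Rightarrow> (real ^ 'n \<Rightarrow> real) set" where
  "mixed_space m = {f.
     continuous_on cube f \<and>
     (\<forall>n. n \<le> (\<lambda>j. m j - 1) \<longrightarrow> (\<exists>g. has_distr_deriv f n g \<and> continuous_on cube g)) \<and>
     (\<exists>g. has_distr_deriv f m g \<and> square_integrable_on g cube)}"


section \<open>Multivariate Gegenbauer expansions\<close>

definition mgegenbauer :: "real \<Rightarrow> ('n \<Rightarrow> nat) \<Rightarrow> real ^ 'n \<Rightarrow> real" where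
  "mgegenbauer lam k x = (\<Prod>j\<in>UNIV. poly (gegenbauer lam (k j)) (x $ j))"

definition mgegenbauer_norm :: "real \<Rightarrow> ('n::finite \<Rightarrow> nat) \<Rightarrow> real" where
  "mgegenbauer_norm lam k = (\<Prod>j\<in>UNIV. gegenbauer_norm lam (k j))"

text \<open>The weight \<open>\<omega>\<close> with parameter \<open>lam + n\<close>; the weight with parameter \<open>lam\<close> is the case \<open>n = 0\<close>.\<close>

definition mweight :: "real \<Rightarrow> ('n \<Rightarrow> nat) \<Rightarrow> real ^ 'n \<Rightarrow> real" where
  "mweight lam n x = (\<Prod>j\<in>UNIV. gegenbauer_weight (lam + real (n j)) (x $ j))"

definition gegenbauer_coeff :: "real \<Rightarrow> (real ^ 'n \<Rightarrow> real) \<Rightarrow> ('n \<Rightarrow> nat) \<Rightarrow> real" where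
  "gegenbauer_coeff lam f k =
     1 / mgegenbauer_norm lam k *
       (LINT x:cube|lebesgue. f x * mgegenbauer lam k x * mweight lam (\<lambda>_. 0) x)"

definition multi_min :: "('n \<Rightarrow> nat) \<Rightarrow> ('n \<Rightarrow> nat) \<Rightarrow> 'n \<Rightarrow> nat" where
  "multi_min k m = (\<lambda>j. min (k j) (m j))"

text \<open>
  The quantity \<open>V\<close> with values in \<open>[0, \<infinity>]\<close>. For \<open>p = min {k, m}\<close> with \<open>p \<le> m - 1\<close> or \<open>p = m\<close> the
  derivative \<open>\<partial>\<^sup>p f\<close> of \<open>f \<in> H\<^sup>m\<close> is a function and \<open>V\<close> is finite. The remaining mixed orders are not
  controlled by the definition of \<open>H\<^sup>m\<close>: for \<open>d = 2\<close>, \<open>m = (1, 1)\<close>, \<open>f (x, y) = w x\<close> with \<open>w\<close> continuous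
  and nowhere differentiable lies in \<open>H\<^sup>m\<close>, but its derivative of order \<open>(1, 0)\<close> is not a
  function. As usual, \<open>V = \<infinity>\<close> if the distribution \<open>\<partial>\<^sup>p f\<close> does not belong to the weighted \<open>L\<^sup>2\<close> space.
\<close>

definition gegenbauer_V ::
    "real \<Rightarrow> (real ^ 'n \<Rightarrow> real) \<Rightarrow> ('n \<Rightarrow> nat) \<Rightarrow> ('n \<Rightarrow> nat) \<Rightarrow> ereal" where
  "gegenbauer_V lam f k m =
     (let p = multi_min k m;
          F = (\<lambda>x. \<bar>distr_deriv p f x\<bar>\<^sup>2 * mweight lam p x)
      in if (\<exists>g. has_distr_deriv f p g) \<and> set_integrable lebesgue cube F
         then ereal (sqrt (LINT x:cube|lebesgue. F x))
         else \<infinity>)"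

end

theory Submission
  imports Defs
begin

text \<open>
  Let \<open>p = min {k, m}\<close>. Rodrigues' formula writes \<open>C\<^sub>k\<close> times its weight as a constant times the \<open>p\<close>-th
  derivative of \<open>\<Phi>\<close>, the product of the polynomials \<open>C\<close> of parameter \<open>lam + p\<close> and degree \<open>k - p\<close>
  with the weight of parameter \<open>lam + p\<close>. Moving the derivatives to \<open>f\<close> and applying the
  Cauchy-Schwarz inequality gives the bound; the constants multiply up to the stated products.

  As \<open>\<Phi>\<close> is not a test function, the integration by parts needs an approximation. With
  \<open>u = 1 - x\<^sup>2\<close> and \<open>w = e / (u - e)\<close>, each one-dimensional factor \<open>P u\<^sup>a\<close> is replaced by \<open>P u\<^sup>a exp (-w)\<close>,
  cut off to \<open>0\<close> where \<open>u \<le> e\<close>. Since \<open>w' = 2 x (w\<^sup>2 + w) / u\<close>, the \<open>n\<close>-th derivative of such a function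
  is \<open>u\<close> to the power \<open>a - n\<close> times \<open>Q (x, w) exp (-w)\<close> with a polynomial \<open>Q\<close> that does not depend on \<open>e\<close>.
  Hence all derivatives are dominated by weights uniformly in \<open>e\<close>, and they converge pointwise as
  \<open>e \<rightarrow> 0\<close>, that is \<open>w \<rightarrow> 0\<close>.
\<close>

section \<open>Smooth cut-off functions on the interval\<close>

text \<open>The outer variable is \<open>w\<close>, the coefficients are polynomials in \<open>x\<close>.\<close>

definition eval2 :: "real poly poly \<Rightarrow> real \<Rightarrow> real \<Rightarrow> real" where
  "eval2 Q x w = poly (poly Q [:w:]) x"

lemma eval2_simps [simp]:
  "eval2 0 x w = 0"
  "eval2 (pCons a Q) x w = poly a x + w * eval2 Q x w"
  "eval2 (Q + R) x w = eval2 Q x w + eval2 R x w"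
  "eval2 (Q - R) x w = eval2 Q x w - eval2 R x w"
  "eval2 (Q * R) x w = eval2 Q x w * eval2 R x w"
  "eval2 (smult a Q) x w = poly a x * eval2 Q x w"
  by (simp_all add: eval2_def)

lemma eval2_at_0: "eval2 Q x 0 = poly (coeff Q 0) x"
  by (induction Q) simp_all

text \<open>Chain rule for \<open>Q (x, w)\<close> along \<open>w = W x\<close>:
  \<open>map_poly pderiv\<close> differentiates the coefficients and so acts in \<open>x\<close>,
  while \<open>pderiv\<close> acts in the outer variable \<open>w\<close>.\<close>

lemma has_real_derivative_eval2:
  assumes "(W has_real_derivative W') (at x)"
  shows "((\<lambda>y. eval2 Q y (W y)) has_real_derivative
      eval2 (map_poly pderiv Q) x (W x) + eval2 (pderiv Q) x (W x) * W') (at x)"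
proof (induction Q)
  case (pCons a Q)
  show ?case
    by (auto intro!: derivative_eq_intros pCons.IH assms
        simp: map_poly_pCons pderiv_pCons algebra_simps)
qed simp

lemma continuous_eval2: "continuous (at t) (eval2 Q x)"
  by (induction Q) (auto intro!: continuous_intros simp: eval2_simps(2)[abs_def] eval2_simps(1)[abs_def])

text \<open>The term of index \<open>r\<close> of the exponential series at \<open>1 + w\<close> is
  at most the whole sum; the factor \<open>exp 1\<close> pays for the shift by one.\<close>

lemma power_times_exp_bounded:
  assumes "(w::real) \<ge> 0"
  shows "(1 + w) ^ r * exp (- w) \<le> fact r * exp 1"
proof -
  have "(1 + w) ^ r / fact r \<le> exp (1 + w)"
  proof -
    have "(\<Sum>n\<in>{r}. inverse (fact n) * (1 + w) ^ n) \<le> (\<Sum>n. inverse (fact n) * (1 + w) ^ n)"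
      using assms by (intro sum_le_suminf summable_exp) auto
    then show ?thesis by (simp add: exp_def field_simps)
  qed
  then have "(1 + w) ^ r \<le> fact r * exp 1 * exp w"
    by (simp add: field_simps exp_add)
  then show ?thesis by (simp add: exp_minus field_simps)
qed

lemma poly_bounded_unit_interval:
  obtains A where "A \<ge> 0" "\<And>x::real. \<bar>x\<bar> \<le> 1 \<Longrightarrow> \<bar>poly p x\<bar> \<le> A"
proof -
  have "compact ((\<lambda>x. poly p x) ` {-1..1})"
    by (intro compact_continuous_image continuous_intros) auto
  then obtain A where "\<And>y. y \<in> (\<lambda>x. poly p x) ` {-1..1} \<Longrightarrow> \<bar>y\<bar> \<le> A"
    using compact_imp_bounded bounded_iff by (metis real_norm_def)
  then have "\<And>x. \<bar>x\<bar> \<le> 1 \<Longrightarrow> \<bar>poly p x\<bar> \<le> A" by (auto simp: abs_le_iff)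
  moreover from this[of 0] have "A \<ge> 0" by auto
  ultimately show ?thesis using that by blast
qed

text \<open>The exponent \<open>r\<close> is needed for the induction: the factor \<open>w\<close> of the outer variable raises it by one.\<close>

lemma eval2_times_exp_bounded:
  "\<exists>K\<ge>0. \<forall>x w. \<bar>x\<bar> \<le> 1 \<longrightarrow> w \<ge> 0 \<longrightarrow> \<bar>eval2 Q x w\<bar> * (1 + w) ^ r * exp (- w) \<le> K"
proof (induction Q arbitrary: r)
  case 0
  show ?case by auto
next
  case (pCons a Q)
  obtain K where K: "K \<ge> 0" "\<And>x w. \<bar>x\<bar> \<le> 1 \<Longrightarrow> w \<ge> 0 \<Longrightarrow>
      \<bar>eval2 Q x w\<bar> * (1 + w) ^ Suc r * exp (- w) \<le> K"
    using pCons.IH[of "Suc r"] by blast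
  obtain A where A: "A \<ge> 0" "\<And>x. \<bar>x\<bar> \<le> 1 \<Longrightarrow> \<bar>poly a x\<bar> \<le> A"
    using poly_bounded_unit_interval by blast
  have "\<bar>eval2 (pCons a Q) x w\<bar> * (1 + w) ^ r * exp (- w) \<le> A * (fact r * exp 1) + K"
    if "\<bar>x\<bar> \<le> 1" "w \<ge> 0" for x w
  proof -
    have "\<bar>eval2 (pCons a Q) x w\<bar> * (1 + w) ^ r * exp (- w)
        \<le> (\<bar>poly a x\<bar> + (1 + w) * \<bar>eval2 Q x w\<bar>) * ((1 + w) ^ r * exp (- w))"
    proof -
      have "\<bar>w * eval2 Q x w\<bar> \<le> (1 + w) * \<bar>eval2 Q x w\<bar>"
        unfolding abs_mult using that by (intro mult_right_mono) auto
      then have "\<bar>eval2 (pCons a Q) x w\<bar> \<le> \<bar>poly a x\<bar> + (1 + w) * \<bar>eval2 Q x w\<bar>"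
        by (simp only: eval2_simps)
      then show ?thesis
        unfolding mult.assoc using that by (intro mult_right_mono) simp_all
    qed
    also have "\<dots> = \<bar>poly a x\<bar> * ((1 + w) ^ r * exp (- w))
        + \<bar>eval2 Q x w\<bar> * (1 + w) ^ Suc r * exp (- w)"
      by (simp add: algebra_simps)
    also have "\<dots> \<le> A * (fact r * exp 1) + K"
      unfolding mult.assoc[of "\<bar>poly a x\<bar>"]
      by (intro add_mono mult_mono A K that power_times_exp_bounded) (use A that in auto)
    finally show ?thesis .
  qed
  then show ?case using A K by (intro exI[of _ "A * (fact r * exp 1) + K"]) auto
qed

section \<open>Cut-off functions and their derivatives\<close>

definition cutoff_arg :: "real \<Rightarrow> real \<Rightarrow> real" where
  "cutoff_arg e x = e / (1 - x\<^sup>2 - e)"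

text \<open>For \<open>e > 0\<close> the base \<open>1 - x^2\<close> exceeds \<open>e\<close>
  wherever the first branch applies, so the negative exponents \<open>a\<close> that arise after
  many differentiations do no harm.\<close>

definition cutoff_fun :: "real \<Rightarrow> real \<Rightarrow> real poly poly \<Rightarrow> real \<Rightarrow> real" where
  "cutoff_fun e a Q x =
     (if 1 - x\<^sup>2 > e
      then (1 - x\<^sup>2) powr a * (eval2 Q x (cutoff_arg e x) * exp (- cutoff_arg e x)) else 0)"

text \<open>With \<open>u = 1 - x^2\<close>, this is what remains of the derivative of
  \<open>u powr a * Q (x, w) * exp (- w)\<close> after \<open>u powr (a - 1) * exp (- w)\<close> is
  taken out. The summands come from the coefficients of \<open>Q\<close>, from
  \<open>u powr a\<close>, and from the dependence on \<open>w\<close>; in the last one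
  \<open>[:0, 1, 1:]\<close> stands for \<open>w + w^2\<close> and \<open>pderiv Q - Q\<close> comes
  from \<open>Q * exp (- w)\<close>.\<close>

definition cutoff_step :: "real \<Rightarrow> real poly poly \<Rightarrow> real poly poly" where
  "cutoff_step a Q = smult [:1, 0, -1:] (map_poly pderiv Q) - smult [:0, 2 * a:] Q
     + smult [:0, 2:] ([:0, 1, 1:] * (pderiv Q - Q))"

text \<open>Handles the points with \<open>1 - x^2 \<le> e\<close>, in particular the edge of the
  support, where the two branches of \<open>cutoff_fun\<close> meet.\<close>

lemma has_derivative_zero_if_quadratic:
  fixes g :: "real \<Rightarrow> real"
  assumes "\<And>y. \<bar>g y\<bar> \<le> C * (y - x)\<^sup>2"
  shows "(g has_real_derivative 0) (at x)"
proof -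
  have g0: "g x = 0" using assms[of x] by simp
  have "((\<lambda>h. (g (x + h) - g x) / h) \<longlongrightarrow> 0) (at 0)"
  proof (rule Lim_null_comparison)
    have "\<bar>g (x + h) / h\<bar> \<le> C * \<bar>h\<bar>" if "h \<noteq> 0" for h
    proof -
      have "\<bar>g (x + h)\<bar> \<le> (C * \<bar>h\<bar>) * \<bar>h\<bar>"
        using assms[of "x + h"] by (simp add: power2_eq_square)
      then show ?thesis using that by (simp add: pos_divide_le_eq)
    qed
    then show "\<forall>\<^sub>F h in at 0. norm ((g (x + h) - g x) / h) \<le> C * \<bar>h\<bar>"
      using g0 by (auto simp: eventually_at_filter)
    show "((\<lambda>h. C * \<bar>h\<bar>) \<longlongrightarrow> 0) (at 0)"
      by (auto intro!: tendsto_eq_intros)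
  qed
  then show ?thesis by (simp add: DERIV_def)
qed

text \<open>The exponential beats \<open>(1 + w)^2\<close>, and
  \<open>1 / (1 + w) = (u - e) / u\<close> is of first order in the distance from \<open>y\<close>
  to the region where the function vanishes. The exponent 2 thus yields a quadratic bound.\<close>

lemma cutoff_fun_quadratic:
  assumes "e > 0" "1 - x\<^sup>2 \<le> e"
  shows "\<exists>C. \<forall>y. \<bar>cutoff_fun e a Q y\<bar> \<le> C * (y - x)\<^sup>2"
proof -
  obtain K where K: "K \<ge> 0" "\<And>x w. \<bar>x\<bar> \<le> 1 \<Longrightarrow> w \<ge> 0 \<Longrightarrow>
      \<bar>eval2 Q x w\<bar> * (1 + w) ^ 2 * exp (- w) \<le> K"
    using eval2_times_exp_bounded[of Q 2] by blast
  \<comment> \<open>On the support \<open>u\<close> lies between \<open>e\<close> and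
    \<open>1\<close>, so \<open>u powr a\<close> is at most \<open>1\<close> for
    \<open>a \<ge> 0\<close> and at most \<open>e powr a\<close> for \<open>a < 0\<close>.\<close>
  define M where "M = max 1 (e powr a)"
  have "\<bar>cutoff_fun e a Q y\<bar> \<le> M * (K * ((\<bar>x\<bar> + 1)\<^sup>2 / e\<^sup>2)) * (y - x)\<^sup>2" for y
  proof (cases "1 - y\<^sup>2 > e")
    case True
    define u where "u = 1 - y\<^sup>2"
    define w where "w = cutoff_arg e y"
    have u: "e < u" "u \<le> 1" using True by (auto simp: u_def)
    have w: "w = e / (u - e)" "w \<ge> 0" using u assms by (auto simp: w_def u_def cutoff_arg_def)
    have y: "\<bar>y\<bar> \<le> 1" using True assms by (simp add: abs_square_le_1[symmetric])
    have 1: "u powr a \<le> M"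
    proof (cases "a \<ge> 0")
      case True
      then show ?thesis using u assms powr_le_one_le powr_mono2[of a u 1] by (auto simp: M_def)
    next
      case False
      then show ?thesis using u assms powr_mono2'[of a e u] by (auto simp: M_def)
    qed
    have "\<bar>eval2 Q y w\<bar> * exp (- w) \<le> K / (1 + w)\<^sup>2"
      using K(2)[OF y w(2)] w(2) by (simp add: field_simps)
    also have "K / (1 + w)\<^sup>2 = K * ((u - e)\<^sup>2 / u\<^sup>2)"
    proof -
      have "1 + w = u / (u - e)" using u w by (simp add: field_simps)
      then show ?thesis by (simp add: power_divide)
    qed
    also have "\<dots> \<le> K * ((\<bar>x\<bar> + 1)\<^sup>2 * (y - x)\<^sup>2 / e\<^sup>2)"
    proof (intro mult_left_mono frac_le)
      \<comment> \<open>Here the position of \<open>x\<close> enters: \<open>1 - x^2 \<le> e\<close>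
        bounds \<open>u - e\<close> by a difference of squares, which has the factor
        \<open>y - x\<close>.\<close>
      have "u - e \<le> x\<^sup>2 - y\<^sup>2" using assms by (simp add: u_def)
      also have "\<dots> = (x + y) * (x - y)" by (simp add: algebra_simps power2_eq_square)
      also have "\<dots> \<le> \<bar>x + y\<bar> * \<bar>x - y\<bar>" by (simp flip: abs_mult)
      also have "\<dots> \<le> (\<bar>x\<bar> + 1) * \<bar>y - x\<bar>" using y by (intro mult_mono) auto
      finally have "(u - e)\<^sup>2 \<le> ((\<bar>x\<bar> + 1) * \<bar>y - x\<bar>)\<^sup>2" using u by (intro power_mono) auto
      then show "(u - e)\<^sup>2 \<le> (\<bar>x\<bar> + 1)\<^sup>2 * (y - x)\<^sup>2" by (simp add: power_mult_distrib)
      show "e\<^sup>2 \<le> u\<^sup>2" using u assms by (intro power_mono) auto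
    qed (use K assms in auto)
    finally have 2: "\<bar>eval2 Q y w\<bar> * exp (- w) \<le> K * ((\<bar>x\<bar> + 1)\<^sup>2 * (y - x)\<^sup>2 / e\<^sup>2)" .
    have "\<bar>cutoff_fun e a Q y\<bar> = u powr a * (\<bar>eval2 Q y w\<bar> * exp (- w))"
      using True by (simp add: cutoff_fun_def u_def w_def abs_mult)
    also have "\<dots> \<le> M * (K * ((\<bar>x\<bar> + 1)\<^sup>2 * (y - x)\<^sup>2 / e\<^sup>2))"
      by (rule mult_mono[OF 1 2]) (auto simp: M_def)
    finally show ?thesis by (simp add: mult_ac)
  next
    case False
    then show ?thesis using K by (simp add: cutoff_fun_def M_def)
  qed
  then show ?thesis by blast
qed

text \<open>Where \<open>1 - x^2 > e\<close> this is the product rule on an open set; at all other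
  points the quadratic bound makes the derivative zero, as the formula demands. The class of cut-off
  functions is therefore closed under differentiation.\<close>

lemma has_real_derivative_cutoff_fun:
  assumes e: "e > 0"
  shows "(cutoff_fun e a Q has_real_derivative cutoff_fun e (a - 1) (cutoff_step a Q) x) (at x)"
proof (cases "1 - x\<^sup>2 > e")
  case True
  define u where "u = 1 - x\<^sup>2"
  define w where "w = cutoff_arg e x"
  have u: "u > e" "u > 0" using True e by (auto simp: u_def)
  have w: "w = e / (u - e)" by (simp add: w_def u_def cutoff_arg_def)
  have dw: "(cutoff_arg e has_real_derivative 2 * x * (w\<^sup>2 + w) / u) (at x)"
  proof -
    have "(cutoff_arg e has_real_derivative e * 2 * x / (u - e)\<^sup>2) (at x)"
      unfolding cutoff_arg_def[abs_def] using u
      by (auto intro!: derivative_eq_intros simp: u_def power2_eq_square field_simps)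
    \<comment> \<open>From \<open>w = e / (u - e)\<close> one gets
      \<open>w^2 + w = e * u / (u - e)^2\<close>, so the derivative of \<open>w\<close> is again
      polynomial in \<open>x\<close> and \<open>w\<close>, up to the factor
      \<open>1 / u\<close>.\<close>
    also have "e * 2 * x / (u - e)\<^sup>2 = 2 * x * (w\<^sup>2 + w) / u"
      using u e by (simp add: w divide_simps) (simp add: power2_eq_square algebra_simps)
    finally show ?thesis .
  qed
  have du: "((\<lambda>y. (1 - y\<^sup>2) powr a) has_real_derivative u powr (a - 1) * (- 2 * a * x)) (at x)"
    using u by (auto intro!: derivative_eq_intros simp: u_def powr_diff field_simps)
  have P: "u powr a = u powr (a - 1) * u" using u by (simp add: powr_diff)
  have "((\<lambda>y. (1 - y\<^sup>2) powr a * (eval2 Q y (cutoff_arg e y) * exp (- cutoff_arg e y)))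
     has_real_derivative cutoff_fun e (a - 1) (cutoff_step a Q) x) (at x)"
  proof -
    have "((\<lambda>y. exp (- cutoff_arg e y)) has_real_derivative
        - (2 * x * (w\<^sup>2 + w) / u) * exp (- w)) (at x)"
      unfolding w_def by (rule derivative_eq_intros dw[unfolded w_def] refl)+ simp
    note D = DERIV_mult[OF du DERIV_mult[OF has_real_derivative_eval2[OF dw, of Q] this]]
    define p X E1 E2 E3 where "p = u powr (a - 1)" "X = exp (- w)" "E1 = eval2 Q x w"
      "E2 = eval2 (map_poly pderiv Q) x w" "E3 = eval2 (pderiv Q) x w"
    note defs = this
    define q where "q = 2 * x * (w\<^sup>2 + w) / u"
    have q: "2 * x * (w\<^sup>2 + w) = q * u" using u by (simp add: q_def)
    have "p * (- 2 * a * x) * (E1 * X) + ((E2 + E3 * q) * X + - q * X * E1) * (p * u)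
      = p * X * (u * E2 - 2 * a * x * E1 + 2 * x * (w\<^sup>2 + w) * (E3 - E1))"
      unfolding q by (simp add: algebra_simps)
    moreover have "cutoff_fun e (a - 1) (cutoff_step a Q) x
      = p * X * (u * E2 - 2 * a * x * E1 + (2 * x * (w\<^sup>2 + w)) * (E3 - E1))"
      using True by (simp add: cutoff_fun_def cutoff_step_def defs flip: u_def w_def)
        (simp add: u_def power2_eq_square algebra_simps)
    ultimately show ?thesis
      by (intro DERIV_cong[OF D]) (simp only: defs P q_def flip: w_def u_def)
  qed
  then show ?thesis
  proof (rule has_field_derivative_transform_within_open)
    show "open {y::real. 1 - y\<^sup>2 > e}"
      by (intro open_Collect_less continuous_intros)
  qed (use True in \<open>auto simp: cutoff_fun_def\<close>)
next
  case False
  then obtain C where "\<And>y. \<bar>cutoff_fun e a Q y\<bar> \<le> C * (y - x)\<^sup>2"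
    using cutoff_fun_quadratic[OF e, of x a Q] by auto
  then have "(cutoff_fun e a Q has_real_derivative 0) (at x)"
    by (rule has_derivative_zero_if_quadratic)
  moreover have "cutoff_fun e (a - 1) (cutoff_step a Q) x = 0"
    using False by (simp add: cutoff_fun_def)
  ultimately show ?thesis by simp
qed

text \<open>Each differentiation lowers the exponent by one, so step number \<open>n\<close> is
  taken at exponent \<open>a - n\<close>. The recursion does not involve \<open>e\<close>.\<close>

fun cutoff_iter :: "real \<Rightarrow> real poly poly \<Rightarrow> nat \<Rightarrow> real poly poly" where
  "cutoff_iter a Q 0 = Q"
| "cutoff_iter a Q (Suc n) = cutoff_step (a - real n) (cutoff_iter a Q n)"

lemma has_real_derivative_cutoff_iter:
  assumes "e > 0"
  shows "(cutoff_fun e (a - real n) (cutoff_iter a Q n) has_real_derivative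
      cutoff_fun e (a - real (Suc n)) (cutoff_iter a Q (Suc n)) x) (at x)"
  using has_real_derivative_cutoff_fun[OF assms, of "a - real n" "cutoff_iter a Q n"]
  by (simp add: algebra_simps)

text \<open>\<open>Q (x, w) * exp (- w)\<close> is bounded for all \<open>w \<ge> 0\<close> at once,
  so \<open>K\<close> can be chosen before \<open>e\<close>. This provides the majorant for
  dominated convergence.\<close>

lemma cutoff_fun_bounded:
  "\<exists>K\<ge>0. \<forall>e>0. \<forall>x. \<bar>x\<bar> \<le> 1 \<longrightarrow> \<bar>cutoff_fun e a Q x\<bar> \<le> K * (1 - x\<^sup>2) powr a"
proof -
  obtain K where K: "K \<ge> 0" "\<And>x w. \<bar>x\<bar> \<le> 1 \<Longrightarrow> w \<ge> 0 \<Longrightarrow> \<bar>eval2 Q x w\<bar> * exp (- w) \<le> K"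
    using eval2_times_exp_bounded[of Q 0] by auto
  have "\<bar>cutoff_fun e a Q x\<bar> \<le> K * (1 - x\<^sup>2) powr a" if "e > 0" "\<bar>x\<bar> \<le> 1" for e x
  proof (cases "1 - x\<^sup>2 > e")
    case True
    then have "cutoff_arg e x \<ge> 0" using that by (simp add: cutoff_arg_def)
    then have "(1 - x\<^sup>2) powr a * (\<bar>eval2 Q x (cutoff_arg e x)\<bar> * exp (- cutoff_arg e x))
        \<le> (1 - x\<^sup>2) powr a * K"
      using K that by (intro mult_left_mono) auto
    then show ?thesis by (simp add: cutoff_fun_def abs_mult mult_ac K)
  qed (use K in \<open>simp add: cutoff_fun_def\<close>)
  then show ?thesis using K by blast
qed

text \<open>For fixed \<open>x\<close> the cut-off condition holds from some index on and
  \<open>w\<close> tends to \<open>0\<close>; what survives is the coefficient of \<open>Q\<close>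
  of order zero in \<open>w\<close>.\<close>

lemma cutoff_fun_tendsto:
  assumes "\<bar>x\<bar> < 1"
  shows "(\<lambda>i. cutoff_fun (1 / real (Suc i)) a Q x)
           \<longlonglongrightarrow> poly (coeff Q 0) x * (1 - x\<^sup>2) powr a"
proof -
  define u where "u = 1 - x\<^sup>2"
  have u: "u > 0" using assms by (simp add: u_def abs_square_less_1)
  have lim: "(\<lambda>i. 1 / real (Suc i)) \<longlonglongrightarrow> 0"
    using LIMSEQ_inverse_real_of_nat by (simp add: inverse_eq_divide)
  have "(\<lambda>i. cutoff_arg (1 / real (Suc i)) x) \<longlonglongrightarrow> 0 / (u - 0)"
    unfolding cutoff_arg_def u_def[symmetric] by (intro tendsto_intros lim) (use u in auto)
  then have w: "(\<lambda>i. cutoff_arg (1 / real (Suc i)) x) \<longlonglongrightarrow> 0" by simp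
  have "(\<lambda>i. u powr a * (eval2 Q x (cutoff_arg (1 / real (Suc i)) x)
      * exp (- cutoff_arg (1 / real (Suc i)) x)))
      \<longlonglongrightarrow> u powr a * (eval2 Q x 0 * exp (- 0))"
    by (intro tendsto_intros w isCont_tendsto_compose[OF continuous_eval2])
  moreover have "\<forall>\<^sub>F i in sequentially. u powr a * (eval2 Q x (cutoff_arg (1 / real (Suc i)) x)
      * exp (- cutoff_arg (1 / real (Suc i)) x)) = cutoff_fun (1 / real (Suc i)) a Q x"
    using order_tendstoD(2)[OF lim u]
    by eventually_elim (simp add: cutoff_fun_def u_def)
  ultimately show ?thesis
    using Lim_transform_eventually by (fastforce simp: eval2_at_0 u_def mult_ac)
qed

text \<open>The polynomial factor in the derivative of \<open>poly P x * (1 - x^2) powr a\<close>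
  once \<open>(1 - x^2) powr (a - 1)\<close> is taken out.\<close>

definition rodrigues_step :: "real \<Rightarrow> real poly \<Rightarrow> real poly" where
  "rodrigues_step a P = [:1, 0, -1:] * pderiv P - [:0, 2 * a:] * P"

text \<open>At \<open>w = 0\<close> the recursion for the cut-off functions is the one for the functions \<open>P u\<^sup>a\<close>.\<close>

lemma coeff_cutoff_step: "coeff (cutoff_step a Q) 0 = rodrigues_step a (coeff Q 0)"
  by (simp add: cutoff_step_def rodrigues_step_def coeff_map_poly mult_poly_0_left)

section \<open>Gegenbauer polynomials and the Rodrigues formula\<close>

lemma gegenbauer_weight_nonneg: "gegenbauer_weight \<mu> x \<ge> 0"
  by (simp add: gegenbauer_weight_def)

lemma borel_measurable_gegenbauer_weight [measurable]: "gegenbauer_weight \<mu> \<in> borel_measurable borel"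
  unfolding gegenbauer_weight_def[abs_def] by measurable

text \<open>The substitution \<open>t = (x + 1) / 2\<close> turns the Beta integral with both
  parameters \<open>\<mu> + 1/2\<close> into a multiple of the integral of the weight, because
  \<open>4 * t * (1 - t) = 1 - x^2\<close>.\<close>

lemma absolutely_integrable_gegenbauer_weight:
  assumes "\<mu> > 0"
  shows "gegenbauer_weight \<mu> absolutely_integrable_on {-1..1}"
proof (rule nonnegative_absolutely_integrable_1)
  define \<beta> where "\<beta> = \<mu> - 1/2"
  have "((\<lambda>t. t powr \<beta> * (1 - t) powr \<beta>) has_integral Beta (\<mu> + 1/2) (\<mu> + 1/2)) (cbox 0 1)"
    using has_integral_Beta_real[of "\<mu> + 1/2" "\<mu> + 1/2"] assms by (simp add: \<beta>_def)
  from has_integral_affinity[OF this, of "1/2" "1/2"]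
  obtain I where I: "((\<lambda>x. (1/2 * x + 1/2) powr \<beta> * (1 - (1/2 * x + 1/2)) powr \<beta>) has_integral I)
      ((\<lambda>x. 2 * x + -1) ` {0..1::real})"
    by auto
  have im: "(\<lambda>x. 2 * x + -1) ` {0..1::real} = {-1..1}"
    using image_affinity_atLeastAtMost[of 2 "-1" 0 "1::real"] by simp
  have "((\<lambda>x. 4 powr \<beta> * ((1/2 * x + 1/2) powr \<beta> * (1 - (1/2 * x + 1/2)) powr \<beta>))
      has_integral 4 powr \<beta> * I) {-1..1}"
    using has_integral_mult_right[OF I, of "4 powr \<beta>"] unfolding im .
  moreover have "4 powr \<beta> * ((1/2 * x + 1/2) powr \<beta> * (1 - (1/2 * x + 1/2)) powr \<beta>)
      = gegenbauer_weight \<mu> x" if "x \<in> {-1..1}" for x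
  proof -
    have "4 powr \<beta> * ((1/2 * x + 1/2) powr \<beta> * (1 - (1/2 * x + 1/2)) powr \<beta>)
        = (4 * ((1/2 * x + 1/2) * (1 - (1/2 * x + 1/2)))) powr \<beta>"
    proof -
      have *: "(4 * (s * t)) powr \<beta> = 4 powr \<beta> * (s powr \<beta> * t powr \<beta>)" if "s \<ge> 0" "t \<ge> 0" for s t :: real
        using that by (simp add: powr_mult)
      show ?thesis by (rule *[symmetric]) (use that in auto)
    qed
    also have "4 * ((1/2 * x + 1/2) * (1 - (1/2 * x + 1/2))) = 1 - x\<^sup>2"
      by (simp add: field_simps power2_eq_square)
    finally show ?thesis by (simp add: gegenbauer_weight_def \<beta>_def)
  qed
  ultimately have "(gegenbauer_weight \<mu> has_integral 4 powr \<beta> * I) {-1..1}"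
    by (rule has_integral_eq[rotated]) auto
  then show "gegenbauer_weight \<mu> integrable_on {-1..1}" by blast
qed (simp add: gegenbauer_weight_nonneg)

lemma absolutely_integrable_poly_weight:
  assumes "\<mu> > 0"
  shows "(\<lambda>x. poly P x * gegenbauer_weight \<mu> x) absolutely_integrable_on {-1..1}"
proof (rule absolutely_integrable_bounded_measurable_product_real)
  have "continuous_on {-1..1} (poly P)" by (intro continuous_intros)
  then show "poly P \<in> borel_measurable (lebesgue_on {-1..1})"
    by (intro continuous_imp_measurable_on_sets_lebesgue) auto
  show "bounded (poly P ` {-1..1})"
    by (intro compact_imp_bounded compact_continuous_image continuous_intros) auto
qed (use absolutely_integrable_gegenbauer_weight[OF assms] in auto)

section \<open>Weighted integrals of polynomials and integration by parts\<close>

definition weighted_integral :: "real \<Rightarrow> real poly \<Rightarrow> real" where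
  "weighted_integral \<mu> P = (LINT x:{-1..1}|lebesgue. poly P x * gegenbauer_weight \<mu> x)"

lemma weighted_integral_linear:
  assumes "\<mu> > 0"
  shows "weighted_integral \<mu> (P + Q) = weighted_integral \<mu> P + weighted_integral \<mu> Q"
    and "weighted_integral \<mu> (P - Q) = weighted_integral \<mu> P - weighted_integral \<mu> Q"
    and "weighted_integral \<mu> (smult c P) = c * weighted_integral \<mu> P"
  using absolutely_integrable_poly_weight[OF assms, of P] absolutely_integrable_poly_weight[OF assms, of Q]
  by (simp_all add: weighted_integral_def algebra_simps)

lemma weighted_integral_0 [simp]: "weighted_integral \<mu> 0 = 0"
  by (simp add: weighted_integral_def)

text \<open>The integrand is nonnegative and, inside the interval, vanishes only at the finitely
  many roots of \<open>P\<close>. A zero integral would make the open interval a null set.\<close>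

lemma weighted_integral_square_pos:
  assumes "\<mu> > 0" "P \<noteq> 0"
  shows "weighted_integral \<mu> (P * P) > 0"
proof -
  let ?f = "\<lambda>x. indicator {-1..1} x *\<^sub>R (poly (P * P) x * gegenbauer_weight \<mu> x)"
  have int: "integrable lebesgue ?f"
    using absolutely_integrable_poly_weight[OF assms(1)] by (simp only: set_integrable_def)
  have nn: "AE x in lebesgue. 0 \<le> ?f x"
    by (intro AE_I2) (simp add: gegenbauer_weight_nonneg indicator_def)
  have "weighted_integral \<mu> (P * P) \<noteq> 0"
  proof
    assume "weighted_integral \<mu> (P * P) = 0"
    then have AE: "AE x in lebesgue. ?f x = 0"
      using integral_nonneg_eq_0_iff_AE[OF int nn]
      by (simp only: weighted_integral_def set_lebesgue_integral_def)
    have "finite {x. poly P x = 0}" using assms by (simp add: poly_roots_finite)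
    then have "AE x in lebesgue. x \<notin> {x. poly P x = 0}"
      by (intro AE_not_in) (simp add: negligible_finite flip: negligible_iff_null_sets)
    with AE have "AE x in lebesgue. x \<notin> {-1<..<1::real}"
    proof eventually_elim
      case (elim x)
      then show ?case
        by (auto simp: gegenbauer_weight_def indicator_def abs_square_eq_1 power2_eq_1_iff
            split: if_splits)
    qed
    then have "{-1<..<1::real} \<in> null_sets lebesgue"
      by (subst (asm) AE_iff_null_sets[symmetric]) auto
    then show False by (auto simp: null_sets_def)
  qed
  moreover have "weighted_integral \<mu> (P * P) \<ge> 0"
    unfolding weighted_integral_def set_lebesgue_integral_def
    using nn by (rule integral_nonneg_AE)
  ultimately show ?thesis by simp
qed

lemma has_real_derivative_rodrigues_step:
  assumes "\<bar>x\<bar> < 1"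
  shows "((\<lambda>x. poly P x * (1 - x\<^sup>2) powr a) has_real_derivative
     poly (rodrigues_step a P) x * (1 - x\<^sup>2) powr (a - 1)) (at x)"
proof -
  define u where "u = 1 - x\<^sup>2"
  have u: "u > 0" using assms by (simp add: u_def abs_square_less_1)
  have du: "((\<lambda>y. (1 - y\<^sup>2) powr a) has_real_derivative u powr (a - 1) * (- 2 * a * x)) (at x)"
    using u by (auto intro!: derivative_eq_intros simp: u_def powr_diff field_simps)
  have P: "u powr a = u powr (a - 1) * u" using u by (simp add: powr_diff)
  have "poly (pderiv P) x * u powr a + u powr (a - 1) * (- 2 * a * x) * poly P x
      = poly (rodrigues_step a P) x * u powr (a - 1)"
    unfolding P by (simp add: rodrigues_step_def u_def algebra_simps power2_eq_square)
  then show ?thesis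
    using DERIV_mult[OF poly_DERIV du, of P] by (simp add: u_def)
qed

text \<open>The integrand is the derivative of \<open>P * u powr (\<mu> + 1/2)\<close> with
  \<open>u = 1 - x^2\<close>, and this function vanishes at both end points.\<close>

lemma weighted_integral_rodrigues_step:
  assumes "\<mu> > 0"
  shows "weighted_integral \<mu> (rodrigues_step (\<mu> + 1/2) P) = 0"
proof -
  have "((\<lambda>x. poly (rodrigues_step (\<mu> + 1/2) P) x * (1 - x\<^sup>2) powr (\<mu> + 1/2 - 1)) has_integral
     poly P 1 * (1 - 1\<^sup>2) powr (\<mu> + 1/2) - poly P (-1) * (1 - (-1)\<^sup>2) powr (\<mu> + 1/2)) {-1..1}"
  \<comment> \<open>The exponent \<open>\<mu> - 1/2\<close> of the derivative may be negative, so
    differentiability is claimed only inside the interval.\<close>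
  proof (rule fundamental_theorem_of_calculus_interior)
    show "continuous_on {-1..1} (\<lambda>x. poly P x * (1 - x\<^sup>2) powr (\<mu> + 1/2))"
      using assms by (intro continuous_intros continuous_on_powr') (auto simp: abs_square_le_1 power2_eq_1_iff)
    show "((\<lambda>x. poly P x * (1 - x\<^sup>2) powr (\<mu> + 1/2)) has_vector_derivative
       poly (rodrigues_step (\<mu> + 1/2) P) x * (1 - x\<^sup>2) powr (\<mu> + 1/2 - 1)) (at x)"
      if "x \<in> {-1<..<1}" for x
      using that by (intro has_real_derivative_iff_has_vector_derivative[THEN iffD1]
        has_real_derivative_rodrigues_step) auto
  qed auto
  then have "((\<lambda>x. poly (rodrigues_step (\<mu> + 1/2) P) x * gegenbauer_weight \<mu> x) has_integral 0) {-1..1}"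
    by (simp add: gegenbauer_weight_def)
  then show ?thesis
    using absolutely_integrable_poly_weight[OF assms, of "rodrigues_step (\<mu> + 1/2) P"]
    by (simp add: weighted_integral_def set_lebesgue_integral_eq_integral integral_unique)
qed

text \<open>By the product rule, \<open>rodrigues_step\<close> of \<open>P * q\<close> is
  \<open>rodrigues_step\<close> of \<open>P\<close> times \<open>q\<close> plus
  \<open>(1 - x^2) * P * pderiv q\<close>. The first expression integrates to zero, and the factor
  \<open>1 - x^2\<close> raises the parameter of the weight by one.\<close>

lemma weighted_integral_by_parts:
  assumes "\<mu> > 0"
  shows "weighted_integral \<mu> (rodrigues_step (\<mu> + 1/2) P * q) = - weighted_integral (\<mu> + 1) (P * pderiv q)"
proof -
  have "rodrigues_step (\<mu> + 1/2) P * q = rodrigues_step (\<mu> + 1/2) (P * q) - [:1, 0, -1:] * (P * pderiv q)"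
    by (simp add: rodrigues_step_def pderiv_mult algebra_simps)
  moreover have "weighted_integral \<mu> ([:1, 0, -1:] * (P * pderiv q)) = weighted_integral (\<mu> + 1) (P * pderiv q)"
    unfolding weighted_integral_def
  proof (rule set_lebesgue_integral_cong)
    show "\<forall>x. x \<in> {-1..1} \<longrightarrow> poly ([:1, 0, -1:] * (P * pderiv q)) x * gegenbauer_weight \<mu> x =
      poly (P * pderiv q) x * gegenbauer_weight (\<mu> + 1) x"
    proof safe
      fix x :: real
      assume "x \<in> {-1..1}"
      then have "(1 - x\<^sup>2) powr (\<mu> + 1 - 1/2) = (1 - x\<^sup>2) powr (\<mu> - 1/2) * (1 - x\<^sup>2)"
        using powr_mult_base[of "1 - x\<^sup>2" "\<mu> - 1/2"] by (auto simp: abs_square_le_1 abs_le_iff ac_simps)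
      then have "gegenbauer_weight (\<mu> + 1) x = gegenbauer_weight \<mu> x * (1 - x\<^sup>2)"
        by (simp only: gegenbauer_weight_def)
      moreover have "poly [:1, 0, -1:] x = 1 - x\<^sup>2" by (simp add: power2_eq_square)
      ultimately show "poly ([:1, 0, -1:] * (P * pderiv q)) x * gegenbauer_weight \<mu> x =
        poly (P * pderiv q) x * gegenbauer_weight (\<mu> + 1) x"
        by (simp only: poly_mult mult_ac)
    qed
  qed auto
  ultimately show ?thesis
    using assms by (simp add: weighted_integral_linear weighted_integral_rodrigues_step del: mult_pCons_left)
qed

section \<open>Rodrigues polynomials: degree, value at 1, orthogonality\<close>

text \<open>Rodrigues' formula in recursive form: the degree goes down by one while the parameter
  goes up by one. The constant is dictated by the normalization at \<open>1\<close>.\<close>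

fun rodrigues_poly :: "real \<Rightarrow> nat \<Rightarrow> real poly" where
  "rodrigues_poly \<mu> 0 = 1"
| "rodrigues_poly \<mu> (Suc n) =
     smult (- (2 * \<mu> / (real (Suc n) * (real (Suc n) + 2 * \<mu>))))
       (rodrigues_step (\<mu> + 1/2) (rodrigues_poly (\<mu> + 1) n))"

lemma coeff_rodrigues_step_Suc:
  "coeff (rodrigues_step a P) (Suc n) = real (n + 2) * coeff P (n + 2) - (real n + 2 * a) * coeff P n"
  by (cases n) (simp_all add: rodrigues_step_def coeff_pderiv algebra_simps)

text \<open>If \<open>P\<close> has degree \<open>n\<close> and leading coefficient
  \<open>c\<close>, then the coefficient of order \<open>n + 1\<close> of
  \<open>rodrigues_step a P\<close> is \<open>- (n + 2 * a) * c\<close>, which is nonzero for the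
  positive \<open>a = \<mu> + 1/2\<close>.\<close>

lemma degree_coeff_rodrigues_poly:
  assumes "\<mu> > 0"
  shows "degree (rodrigues_poly \<mu> n) = n \<and> coeff (rodrigues_poly \<mu> n) n \<noteq> 0"
  using assms
proof (induction n arbitrary: \<mu>)
  case (Suc n)
  let ?P = "rodrigues_poly (\<mu> + 1) n" and ?R = "rodrigues_step (\<mu> + 1/2) (rodrigues_poly (\<mu> + 1) n)"
  have deg: "degree ?P = n" "coeff ?P n \<noteq> 0" using Suc by auto
  then have "coeff ?R (Suc n) \<noteq> 0"
    using Suc.prems deg by (simp add: coeff_rodrigues_step_Suc coeff_eq_0)
  moreover have "degree ?R \<le> Suc n"
  proof (rule degree_le, safe)
    fix i assume "Suc n < i"
    then obtain j where "i = Suc j" "j > n" by (cases i) auto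
    then show "coeff ?R i = 0" using deg by (simp add: coeff_rodrigues_step_Suc coeff_eq_0)
  qed
  ultimately have "degree ?R = Suc n \<and> coeff ?R (Suc n) \<noteq> 0" by (simp add: le_antisym le_degree)
  then show ?case using Suc.prems by (simp add: add_nonneg_eq_0_iff)
qed simp

lemma degree_rodrigues_poly: "\<mu> > 0 \<Longrightarrow> degree (rodrigues_poly \<mu> n) = n"
  using degree_coeff_rodrigues_poly by blast

lemma Gamma_plus1_real: "(z::real) > 0 \<Longrightarrow> Gamma (z + 1) = z * Gamma z"
  by (rule Gamma_plus1) (auto elim!: nonpos_Ints_cases)

text \<open>At \<open>x = 1\<close> the factor \<open>1 - x^2\<close> removes the derivative term of
  \<open>rodrigues_step\<close>. The rest is the functional equation of \<open>Gamma\<close>, which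
  brings the parameter \<open>\<mu> + 1\<close> of the induction hypothesis back to
  \<open>\<mu>\<close>.\<close>

lemma poly_rodrigues_poly_1:
  assumes "\<mu> > 0"
  shows "poly (rodrigues_poly \<mu> n) 1 = Gamma (real n + 2 * \<mu>) / (fact n * Gamma (2 * \<mu>))"
  using assms
proof (induction n arbitrary: \<mu>)
  case 0
  then have "Gamma (2 * \<mu>) > 0" by (intro Gamma_real_pos) simp
  then show ?case by simp
next
  case (Suc n)
  have pos: "Gamma (2 * \<mu>) > 0" using Suc.prems by (intro Gamma_real_pos) auto
  have 1: "Gamma (2 * (\<mu> + 1)) = (2 * \<mu> + 1) * (2 * \<mu>) * Gamma (2 * \<mu>)"
    using Gamma_plus1_real[of "2 * \<mu>"] Gamma_plus1_real[of "2 * \<mu> + 1"] Suc.prems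
    by (simp add: algebra_simps)
  have 2: "Gamma (real n + 2 * (\<mu> + 1)) = (real n + 1 + 2 * \<mu>) * Gamma (real (Suc n) + 2 * \<mu>)"
    using Gamma_plus1_real[of "real n + 1 + 2 * \<mu>"] Suc.prems by (simp add: algebra_simps)
  have "poly (rodrigues_poly \<mu> (Suc n)) 1 = 2 * \<mu> / (real (Suc n) * (real (Suc n) + 2 * \<mu>)) *
     ((2 * \<mu> + 1) * poly (rodrigues_poly (\<mu> + 1) n) 1)"
  proof -
    have "poly (rodrigues_step (\<mu> + 1/2) P) 1 = - ((2 * \<mu> + 1) * poly P 1)" for P
      by (simp add: rodrigues_step_def algebra_simps)
    then show ?thesis by (simp only: rodrigues_poly.simps poly_smult minus_mult_minus)
  qed
  also have "poly (rodrigues_poly (\<mu> + 1) n) 1 =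
     (real (Suc n) + 2 * \<mu>) * Gamma (real (Suc n) + 2 * \<mu>) /
       (fact n * ((2 * \<mu> + 1) * (2 * \<mu>) * Gamma (2 * \<mu>)))"
    using Suc by (simp only: 1 2) (simp add: algebra_simps)
  also have "2 * \<mu> / (real (Suc n) * (real (Suc n) + 2 * \<mu>)) * ((2 * \<mu> + 1) * \<dots>) =
     Gamma (real (Suc n) + 2 * \<mu>) / (real (Suc n) * fact n * Gamma (2 * \<mu>))"
  proof -
    define s t where "s = real (Suc n) + 2 * \<mu>" "t = 2 * \<mu> + 1"
    have "s > 0" "t > 0" using Suc.prems by (auto simp: s_t_def)
    then show ?thesis using Suc.prems pos unfolding s_t_def[symmetric]
      by (simp add: divide_simps)
  qed
  finally show ?case by simp
qed

text \<open>Integration by parts lowers \<open>n\<close> and the degree of \<open>q\<close>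
  together, until \<open>q\<close> has become zero. The parameter grows on the way, hence the
  induction for arbitrary \<open>\<mu>\<close>. The zero polynomial is listed separately because its
  \<open>degree\<close> is \<open>0\<close> by convention.\<close>

lemma rodrigues_poly_orthogonal:
  assumes "\<mu> > 0" "q = 0 \<or> degree q < n"
  shows "weighted_integral \<mu> (rodrigues_poly \<mu> n * q) = 0"
  using assms
proof (induction n arbitrary: \<mu> q)
  case (Suc n)
  have "pderiv q = 0 \<or> degree (pderiv q) < n"
    using Suc.prems by (cases "degree q") (auto simp: degree_pderiv pderiv_eq_0_iff)
  then have "weighted_integral (\<mu> + 1) (rodrigues_poly (\<mu> + 1) n * pderiv q) = 0"
    using Suc by simp
  then show ?case
    using Suc.prems
    by (simp only: rodrigues_poly.simps mult_smult_left weighted_integral_linear weighted_integral_by_parts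
        minus_zero mult_zero_right)
qed auto

section \<open>Existence and uniqueness of the Gegenbauer family\<close>

lemma gegenbauer_family_rodrigues_poly:
  assumes "\<mu> > 0"
  shows "gegenbauer_family \<mu> (rodrigues_poly \<mu>)"
proof -
  have "weighted_integral \<mu> (rodrigues_poly \<mu> n * rodrigues_poly \<mu> k) = 0" if "n \<noteq> k" for n k
    using rodrigues_poly_orthogonal[OF assms, of "rodrigues_poly \<mu> k" n]
      rodrigues_poly_orthogonal[OF assms, of "rodrigues_poly \<mu> n" k] that
    by (cases "n < k") (auto simp: degree_rodrigues_poly assms mult.commute)
  then show ?thesis
    by (simp add: gegenbauer_family_def degree_rodrigues_poly poly_rodrigues_poly_1 assms
        weighted_integral_def)
qed

lemma gegenbauer_familyD:
  assumes "gegenbauer_family \<mu> C"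
  shows "degree (C n) = n"
    and "n \<noteq> k \<Longrightarrow> weighted_integral \<mu> (C n * C k) = 0"
    and "poly (C n) 1 = Gamma (real n + 2 * \<mu>) / (fact n * Gamma (2 * \<mu>))"
    and "\<mu> > 0 \<Longrightarrow> poly (C n) 1 > 0"
proof -
  note fam = assms[unfolded gegenbauer_family_def]
  show *: "poly (C n) 1 = Gamma (real n + 2 * \<mu>) / (fact n * Gamma (2 * \<mu>))"
    by (rule fam[THEN conjunct2, THEN conjunct2, THEN spec])
  show "poly (C n) 1 > 0" if "\<mu> > 0"
    unfolding * by (intro divide_pos_pos mult_pos_pos Gamma_real_pos) (use that in auto)
  show "degree (C n) = n" by (rule fam[THEN conjunct1, THEN spec])
  show "weighted_integral \<mu> (C n * C k) = 0" if "n \<noteq> k"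
    unfolding weighted_integral_def poly_mult
    using fam[THEN conjunct2, THEN conjunct1, THEN spec, THEN spec, THEN mp, OF that] .
qed

text \<open>As \<open>C i\<close> has degree exactly \<open>i\<close>, the members of index below
  \<open>n\<close> span all polynomials of degree below \<open>n\<close>. The induction on a degree
  bound \<open>N\<close> strips off one member at a time.\<close>

lemma gegenbauer_family_orthogonal:
  assumes "\<mu> > 0" and fam: "gegenbauer_family \<mu> C" and q: "q = 0 \<or> degree q < n"
  shows "weighted_integral \<mu> (C n * q) = 0"
proof -
  note deg = gegenbauer_familyD(1)[OF fam]
  have "poly (C k) 1 > 0" for k using gegenbauer_familyD(4)[OF fam assms(1)] .
  then have "C k \<noteq> 0" for k by (metis less_irrefl poly_0)
  then have lead: "coeff (C k) k \<noteq> 0" for k using deg[of k] leading_coeff_0_iff[of "C k"] by simp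
  have "weighted_integral \<mu> (C n * q) = 0" if "N \<le> n" "q = 0 \<or> degree q < N" for N q
    using that
  proof (induction N arbitrary: q)
    case (Suc N)
    \<comment> \<open>Chosen to cancel the coefficient of order \<open>N\<close>, so that the
      remainder \<open>r\<close> falls under the induction hypothesis.\<close>
    define c where "c = coeff q N / coeff (C N) N"
    define r where "r = q - smult c (C N)"
    have "coeff r i = 0" if "i \<ge> N" for i
    proof (cases "i = N")
      case False
      then show ?thesis using that Suc.prems deg by (auto simp: r_def coeff_eq_0)
    qed (use lead in \<open>simp add: r_def c_def\<close>)
    then have "r = 0 \<or> degree r < N" by (meson leading_coeff_0_iff not_le)
    then have "weighted_integral \<mu> (C n * r) = 0" using Suc by simp
    moreover have "weighted_integral \<mu> (C n * C N) = 0"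
      using gegenbauer_familyD(2)[OF fam] Suc.prems by simp
    moreover have "C n * q = C n * r + smult c (C n * C N)" by (simp add: r_def algebra_simps)
    ultimately show ?case using assms(1) by (simp add: weighted_integral_linear)
  qed auto
  then show ?thesis using q by blast
qed

text \<open>For two such families, cancelling leading coefficients gives
  \<open>q = C n - c * D n\<close> of degree below \<open>n\<close>. Both \<open>C n\<close> and
  \<open>D n\<close> are orthogonal to \<open>q\<close>, so \<open>q\<close> is orthogonal to itself
  and vanishes.\<close>

lemma gegenbauer_eq_rodrigues_poly:
  assumes "\<mu> > 0"
  shows "gegenbauer \<mu> = rodrigues_poly \<mu>"
  unfolding gegenbauer_def
proof (rule the_equality[where P = "gegenbauer_family \<mu>", OF gegenbauer_family_rodrigues_poly[OF assms]], rule ext)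
  fix C n
  assume fam: "gegenbauer_family \<mu> C"
  define D where "D = rodrigues_poly \<mu>"
  have famD: "gegenbauer_family \<mu> D" by (simp add: D_def gegenbauer_family_rodrigues_poly assms)
  note deg = gegenbauer_familyD(1)[OF fam, of n] gegenbauer_familyD(1)[OF famD, of n]
  have at1: "poly (C n) 1 = poly (D n) 1" "poly (D n) 1 > 0"
    using gegenbauer_familyD(3)[OF fam, of n] gegenbauer_familyD(3,4)[OF famD, of n] assms by auto
  then have lead: "coeff (D n) n \<noteq> 0" using deg leading_coeff_0_iff[of "D n"] by auto
  define c where "c = coeff (C n) n / coeff (D n) n"
  define q where "q = C n - smult c (D n)"
  have "coeff q i = 0" if "i \<ge> n" for i
  proof (cases "i = n")
    case False
    then show ?thesis using that deg by (auto simp: q_def coeff_eq_0)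
  qed (use lead in \<open>simp add: q_def c_def\<close>)
  then have "q = 0 \<or> degree q < n" by (meson leading_coeff_0_iff not_le)
  then have "weighted_integral \<mu> (C n * q) = 0" "weighted_integral \<mu> (D n * q) = 0"
    using gegenbauer_family_orthogonal assms fam famD by auto
  moreover have "q * q = C n * q - smult c (D n * q)"
    by (simp only: q_def left_diff_distrib mult_smult_left)
  ultimately have "weighted_integral \<mu> (q * q) = 0" using assms by (simp add: weighted_integral_linear)
  then have "q = 0" using weighted_integral_square_pos[OF assms, of q] by auto
  then have "C n = smult c (D n)" by (simp add: q_def)
  \<comment> \<open>Both polynomials take the same positive value at \<open>1\<close>, which forces
    \<open>c = 1\<close>.\<close>
  then show "C n = rodrigues_poly \<mu> n" using at1 by (simp add: D_def)
qed

lemma gegenbauer_norm_eq: "gegenbauer_norm \<mu> n = weighted_integral \<mu> (gegenbauer \<mu> n * gegenbauer \<mu> n)"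
  by (simp add: gegenbauer_norm_def weighted_integral_def power2_eq_square)

lemma gegenbauer_norm_pos:
  assumes "\<mu> > 0"
  shows "gegenbauer_norm \<mu> n > 0"
proof -
  have "gegenbauer \<mu> n \<noteq> 0"
    using degree_coeff_rodrigues_poly[OF assms, of n]
    by (auto simp: gegenbauer_eq_rodrigues_poly[OF assms])
  then show ?thesis by (simp add: gegenbauer_norm_eq weighted_integral_square_pos assms)
qed

lemma rodrigues_step_gegenbauer:
  assumes "\<mu> > 0"
  shows "rodrigues_step (\<mu> + 1/2) (gegenbauer (\<mu> + 1) n) =
    smult (- (real (Suc n) * (real (Suc n) + 2 * \<mu>) / (2 * \<mu>))) (gegenbauer \<mu> (Suc n))"
proof -
  define N where "N = real (Suc n) * (real (Suc n) + 2 * \<mu>)"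
  have "N > 0" using assms by (simp add: N_def)
  moreover have "gegenbauer \<mu> (Suc n) = smult (- (2 * \<mu> / N)) (rodrigues_step (\<mu> + 1/2) (gegenbauer (\<mu> + 1) n))"
    using assms by (simp only: gegenbauer_eq_rodrigues_poly rodrigues_poly.simps N_def add_pos_pos zero_less_one)
  ultimately show ?thesis
    using assms unfolding N_def[symmetric] by simp
qed

text \<open>In the limit \<open>w = 0\<close>, each differentiation lowers the parameter of the
  Gegenbauer polynomial by one and raises its degree by one. The step that arrives at parameter
  \<open>lam + s\<close> and degree \<open>k - s\<close> contributes the factor with index
  \<open>s\<close>; for \<open>n = p\<close> a multiple of the polynomial with parameter
  \<open>lam\<close> and degree \<open>k\<close> is reached.\<close>

lemma cutoff_iter_gegenbauer:
  assumes "lam > 0" "n \<le> p" "p \<le> k"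
  shows "coeff (cutoff_iter (lam + real p - 1/2) [:gegenbauer (lam + real p) (k - p):] n) 0 =
    smult (\<Prod>s\<in>{p-n..<p}. - ((real k - real s) * (real k + 2 * lam + real s) / (2 * (lam + real s))))
      (gegenbauer (lam + real (p - n)) (k - (p - n)))"
  using assms(2)
proof (induction n)
  case 0
  then show ?case using assms by simp
next
  case (Suc n)
  \<comment> \<open>The parameter offset after the new step; the product is extended at its lower
    end.\<close>
  define s where "s = p - Suc n"
  have s: "p - n = Suc s" "real p - real n = real s + 1" "k - Suc s < k" "s < k" "s < p" "Suc (k - Suc s) = k - s"
    using Suc.prems assms by (auto simp: s_def)
  have eqs: "lam + real p - 1/2 - real n = (lam + real s) + 1/2" "lam + real (Suc s) = lam + real s + 1"
    using s by (auto simp: algebra_simps)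
  have R: "rodrigues_step a (smult c P) = smult c (rodrigues_step a P)" for a c P
    by (simp add: rodrigues_step_def pderiv_smult smult_diff_right)
  have ks: "real (k - s) = real k - real s" using s by simp
  have G: "rodrigues_step (lam + real s + 1/2) (gegenbauer (lam + real s + 1) (k - Suc s)) =
      smult (- ((real k - real s) * (real k + 2 * lam + real s) / (2 * (lam + real s)))) (gegenbauer (lam + real s) (k - s))"
    using rodrigues_step_gegenbauer[of "lam + real s" "k - Suc s"] assms(1) s(6) ks
    by (simp del: of_nat_Suc add: algebra_simps)
  have "coeff (cutoff_iter (lam + real p - 1/2) [:gegenbauer (lam + real p) (k - p):] n) 0 =
    smult (\<Prod>s\<in>{Suc s..<p}. - ((real k - real s) * (real k + 2 * lam + real s) / (2 * (lam + real s))))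
      (gegenbauer (lam + real s + 1) (k - Suc s))"
    using Suc.IH Suc.prems by (simp only: s eqs)
  then show ?case
    unfolding s_def[symmetric]
    by (simp only: cutoff_iter.simps coeff_cutoff_step eqs R G smult_smult
        prod.atLeast_Suc_lessThan[OF s(5)] mult.commute)
qed

section \<open>Product functions on the cube\<close>

lemma partial_deriv_prod:
  fixes h h' :: "'n::finite \<Rightarrow> real \<Rightarrow> real"
  assumes "\<And>t. (h i has_real_derivative h' i t) (at t)"
  shows "partial_deriv i (\<lambda>x. \<Prod>j\<in>UNIV. h j (x $ j)) x =
    (\<Prod>j\<in>UNIV. (if j = i then h' j else h j) (x $ j))"
proof -
  let ?R = "\<Prod>j\<in>UNIV - {i}. h j (x $ j)"
  have "(\<Prod>j\<in>UNIV. h j ((x + t *\<^sub>R axis i 1) $ j)) = h i (x $ i + t) * ?R" for t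
    by (subst prod.remove[of _ i]) (auto simp: axis_def intro!: prod.cong)
  moreover have "((\<lambda>t. h i (x $ i + t) * ?R) has_real_derivative h' i (x $ i) * ?R) (at 0)"
  proof (rule DERIV_cmult_right)
    show "((\<lambda>t. h i (x $ i + t)) has_real_derivative h' i (x $ i)) (at 0)"
      using assms[of "x $ i"] DERIV_shift[of "h i" "h' i (x $ i)" 0 "x $ i"] by (simp add: add.commute)
  qed
  ultimately have "partial_deriv i (\<lambda>x. \<Prod>j\<in>UNIV. h j (x $ j)) x = h' i (x $ i) * ?R"
    unfolding partial_deriv_def by (simp only: DERIV_imp_deriv)
  also have "\<dots> = (\<Prod>j\<in>UNIV. (if j = i then h' j else h j) (x $ j))"
    by (subst (2) prod.remove[of _ i]) (auto intro!: prod.cong)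
  finally show ?thesis .
qed

text \<open>\<open>D j n\<close> plays the role of the \<open>n\<close>-th derivative of the factor
  \<open>j\<close>. Only the number of occurrences of each direction matters, so the enumeration
  chosen in \<open>multi_deriv\<close> has no influence on such products.\<close>

lemma iterated_partial_prod:
  fixes D :: "'n::finite \<Rightarrow> nat \<Rightarrow> real \<Rightarrow> real"
  assumes "\<And>j n t. (D j n has_real_derivative D j (Suc n) t) (at t)"
  shows "iterated_partial is (\<lambda>x. \<Prod>j\<in>UNIV. D j 0 (x $ j)) =
    (\<lambda>x. \<Prod>j\<in>UNIV. D j (count_list is j) (x $ j))"
proof (induction "is")
  case (Cons i "is")
  then have "iterated_partial (i # is) (\<lambda>x. \<Prod>j\<in>UNIV. D j 0 (x $ j)) =
      partial_deriv i (\<lambda>x. \<Prod>j\<in>UNIV. D j (count_list is j) (x $ j))"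
    by (simp add: iterated_partial_def)
  also have "\<dots> = (\<lambda>x. \<Prod>j\<in>UNIV. D j (count_list (i # is) j) (x $ j))"
  proof
    fix x :: "real ^ 'n"
    show "partial_deriv i (\<lambda>x. \<Prod>j\<in>UNIV. D j (count_list is j) (x $ j)) x =
        (\<Prod>j\<in>UNIV. D j (count_list (i # is) j) (x $ j))"
      by (subst partial_deriv_prod[where h = "\<lambda>j. D j (count_list is j)"
            and h' = "\<lambda>j. D j (Suc (count_list is j))"])
        (auto simp: assms intro!: prod.cong)
  qed
  finally show ?case .
qed (simp add: iterated_partial_def)

lemma differentiable_prod_vec_nth:
  fixes h :: "'n::finite \<Rightarrow> real \<Rightarrow> real"
  assumes "\<And>j t. h j differentiable (at t)"
  shows "(\<lambda>x. \<Prod>j\<in>UNIV. h j (x $ j)) differentiable (at x)"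
proof -
  have "(\<lambda>x. \<Prod>j\<in>A. h j (x $ j)) differentiable (at x)" for A
  proof (induction A rule: infinite_finite_induct)
    case (insert j A)
    have "(\<lambda>x. h j (x $ j)) differentiable (at x)"
      using differentiable_chain_at[of "\<lambda>x. x $ j" x "h j"] assms
      by (simp add: o_def bounded_linear_imp_differentiable bounded_linear_vec_nth)
    then show ?case using insert by simp
  qed simp_all
  then show ?thesis .
qed

lemma smooth_prod:
  fixes D :: "'n::finite \<Rightarrow> nat \<Rightarrow> real \<Rightarrow> real"
  assumes "\<And>j n t. (D j n has_real_derivative D j (Suc n) t) (at t)"
  shows "smooth (\<lambda>x. \<Prod>j\<in>UNIV. D j 0 (x $ j))"
  unfolding smooth_def iterated_partial_prod[of D, OF assms] differentiable_on_def
proof (intro allI ballI)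
  fix "is" :: "'n list" and x :: "real ^ 'n"
  have "D j n differentiable (at t)" for j n t
    unfolding real_differentiable_def by (rule exI, rule assms)
  then show "(\<lambda>x. \<Prod>j\<in>UNIV. D j (count_list is j) (x $ j)) differentiable (at x within UNIV)"
    by (rule differentiable_prod_vec_nth)
qed

text \<open>Ensures that the choice in \<open>multi_deriv\<close> is made from a nonempty set. Over
  a finite index type every multi-index is the count function of a multiset, and each multiset comes
  from a list.\<close>

lemma count_list_surj:
  fixes n :: "'n::finite \<Rightarrow> nat"
  shows "\<exists>is. \<forall>i. count_list is i = n i"
proof -
  obtain "is" where "mset is = Abs_multiset n" by (metis ex_mset)
  then have "count (mset is) i = n i" for i by simp
  then show ?thesis by (auto simp: count_mset)
qed

lemma multi_deriv_prod:
  fixes D :: "'n::finite \<Rightarrow> nat \<Rightarrow> real \<Rightarrow> real"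
  assumes "\<And>j n t. (D j n has_real_derivative D j (Suc n) t) (at t)"
  shows "multi_deriv n (\<lambda>x. \<Prod>j\<in>UNIV. D j 0 (x $ j)) = (\<lambda>x. \<Prod>j\<in>UNIV. D j (n j) (x $ j))"
proof -
  have "\<forall>i. count_list (SOME is. \<forall>i. count_list is i = n i) i = n i"
    by (rule someI_ex[OF count_list_surj])
  then show ?thesis
    by (simp only: multi_deriv_def iterated_partial_prod[of D, OF assms])
qed

lemma abs_le_iff_between: "\<bar>t\<bar> \<le> r \<longleftrightarrow> - r \<le> t \<and> t \<le> (r::real)"
  by linarith

lemma mem_interior_cube: "x \<in> interior cube \<longleftrightarrow> (\<forall>j. \<bar>x $ j\<bar> < 1)"
  by (auto simp: cube_def interior_cbox mem_box_cart abs_less_iff minus_less_iff)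

lemma mem_cube: "x \<in> cube \<longleftrightarrow> (\<forall>j. \<bar>x $ j\<bar> \<le> 1)"
  by (simp add: cube_def mem_box_cart abs_le_iff_between)

text \<open>The compact set is the closed cube of half-width \<open>r\<close>: outside of it some
  coordinate exceeds \<open>r\<close> in modulus, and the corresponding factor is zero.\<close>

lemma test_function_prod:
  fixes D :: "'n::finite \<Rightarrow> nat \<Rightarrow> real \<Rightarrow> real"
  assumes "\<And>j n t. (D j n has_real_derivative D j (Suc n) t) (at t)"
    and r: "r < 1" "\<And>j t. \<bar>t\<bar> > r \<Longrightarrow> D j 0 t = 0"
  shows "test_function (interior cube) (\<lambda>x. \<Prod>j\<in>UNIV. D j 0 (x $ j))"
  unfolding test_function_def
proof (intro conjI exI[of _ "cbox (\<chi> i. - r) (\<chi> i. r)"] smooth_prod assms allI impI)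
  show "cbox (\<chi> i. - r) (\<chi> i. r) \<subseteq> interior (cube :: (real ^ 'n) set)"
  proof
    fix x :: "real ^ 'n"
    assume "x \<in> cbox (\<chi> i. - r) (\<chi> i. r)"
    then have "\<bar>x $ j\<bar> \<le> r" for j by (simp add: mem_box_cart abs_le_iff_between)
    then show "x \<in> interior cube" using r(1) by (auto simp: mem_interior_cube intro: le_less_trans)
  qed
  show "(\<Prod>j\<in>UNIV. D j 0 (x $ j)) = 0" if "x \<notin> cbox (\<chi> i. - r) (\<chi> i. r)" for x :: "real ^ 'n"
  proof -
    have "\<not> (\<forall>j. \<bar>x $ j\<bar> \<le> r)"
      using that by (simp add: mem_box_cart abs_le_iff_between)
    then obtain j where "\<bar>x $ j\<bar> > r" by (meson not_le)
    then have "D j 0 (x $ j) = 0" by (rule r(2))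
    then show ?thesis by (intro prod_zero) auto
  qed
qed auto

section \<open>Fubini for product functions and the Cauchy-Schwarz inequality\<close>

text \<open>Lebesgue measure on vectors is the image of a product measure indexed by
  \<open>Basis\<close>. The proof applies Fubini there and translates basis vectors into indices
  through \<open>axis\<close>.\<close>

lemma integral_prod_vec_nth:
  fixes h :: "'n::finite \<Rightarrow> real \<Rightarrow> real"
  assumes "\<And>j. integrable lborel (h j)"
  shows "integrable lborel (\<lambda>x::real ^ 'n. \<Prod>j\<in>UNIV. h j (x $ j))"
    and "(LINT x|lborel. (\<Prod>j\<in>UNIV. h j ((x::real ^ 'n) $ j))) = (\<Prod>j\<in>UNIV. (LINT t|lborel. h j t))"
proof -
  interpret product_sigma_finite "\<lambda>_::real ^ 'n. lborel :: real measure" by standard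
  let ?ax = "\<lambda>j. axis j 1 :: real ^ 'n"
  \<comment> \<open>The factors \<open>h\<close>, indexed by basis vectors in place of
    coordinates.\<close>
  define H where "H b = h (inv ?ax b)" for b
  have inj: "inj ?ax" by (auto simp: inj_def axis_eq_axis)
  have H: "H (?ax j) = h j" for j by (simp add: H_def inv_f_f[OF inj])
  have Basis: "(Basis :: (real ^ 'n) set) = range ?ax" by (auto simp: Basis_vec_def)
  have reindex: "(\<Prod>b\<in>Basis. F b) = (\<Prod>j\<in>UNIV. F (?ax j))" for F :: "real ^ 'n \<Rightarrow> real"
    unfolding Basis by (simp add: prod.reindex[OF inj])
  have intH: "integrable lborel (H b)" for b using assms by (simp add: H_def)
  have [measurable]: "h j \<in> borel_measurable borel" for j
    using assms[of j] by (simp add: borel_measurable_integrable)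
  let ?T = "\<lambda>f. \<Sum>b\<in>Basis. f b *\<^sub>R b :: real ^ 'n"
  have T: "?T \<in> measurable (\<Pi>\<^sub>M b\<in>Basis. lborel) borel"
    by measurable
  have meas: "(\<lambda>x::real ^ 'n. \<Prod>j\<in>UNIV. h j (x $ j)) \<in> borel_measurable borel"
    by measurable
  have comp: "(\<lambda>f. \<Prod>j\<in>UNIV. h j (?T f $ j)) = (\<lambda>f. \<Prod>b\<in>Basis. H b (f b))"
  proof
    fix f :: "real ^ 'n \<Rightarrow> real"
    have "?T f $ j = f (?ax j)" for j
    proof -
      have "?T f $ j = ?T f \<bullet> ?ax j" by (simp add: inner_axis)
      also have "\<dots> = f (?ax j)" by (rule inner_sum_left_Basis) (auto simp: Basis)
      finally show ?thesis .
    qed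
    then show "(\<Prod>j\<in>UNIV. h j (?T f $ j)) = (\<Prod>b\<in>Basis. H b (f b))"
      by (simp add: reindex H)
  qed
  show "integrable lborel (\<lambda>x::real ^ 'n. \<Prod>j\<in>UNIV. h j (x $ j))"
    by (subst lborel_eq, subst integrable_distr_eq[OF T meas], subst comp)
      (intro product_integrable_prod intH finite_Basis)
  have "(LINT x|lborel. (\<Prod>j\<in>UNIV. h j ((x::real ^ 'n) $ j)))
      = (LINT f|(\<Pi>\<^sub>M b\<in>Basis. lborel). (\<Prod>b\<in>Basis. H b (f b)))"
    by (subst lborel_eq, subst integral_distr[OF T meas], subst comp) (rule refl)
  also have "\<dots> = (\<Prod>b\<in>Basis. (LINT t|lborel. H b t))"
    by (intro product_integral_prod intH finite_Basis)
  finally show "(LINT x|lborel. (\<Prod>j\<in>UNIV. h j ((x::real ^ 'n) $ j))) = (\<Prod>j\<in>UNIV. (LINT t|lborel. h j t))"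
    by (simp add: reindex H)
qed

text \<open>The indicator of the cube is itself a product over the coordinates, so the integrand
  extended by zero is a product function on the whole space. Borel measurability of the factors
  permits the passage between \<open>lebesgue\<close> and \<open>lborel\<close>.\<close>

lemma integral_prod_poly_weight:
  fixes P :: "'n::finite \<Rightarrow> real poly" and n :: "'n \<Rightarrow> nat"
  assumes "lam > 0"
  shows "set_integrable lebesgue cube (\<lambda>x. (\<Prod>j\<in>UNIV. poly (P j) (x $ j)) * mweight lam n x)"
    and "(LINT x:cube|lebesgue. (\<Prod>j\<in>UNIV. poly (P j) (x $ j)) * mweight lam n x) =
      (\<Prod>j\<in>UNIV. weighted_integral (lam + real (n j)) (P j))"
proof -
  define h where "h j t = indicator {-1..1} t *\<^sub>R (poly (P j) t * gegenbauer_weight (lam + real (n j)) t)" for j t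
  have h_meas: "h j \<in> borel_measurable borel" for j
  proof -
    have [measurable]: "poly (P j) \<in> borel_measurable borel"
      by (intro borel_measurable_continuous_onI continuous_intros)
    show ?thesis unfolding h_def[abs_def] by measurable
  qed
  have "integrable lebesgue (h j)" for j
    using absolutely_integrable_poly_weight[of "lam + real (n j)" "P j"] assms
    unfolding h_def[abs_def] set_integrable_def by simp
  then have int: "integrable lborel (h j)" for j
    using integrable_completion[of "h j" lborel] h_meas[of j] by simp
  have eq: "(\<lambda>x::real ^ 'n. \<Prod>j\<in>UNIV. h j (x $ j)) =
      (\<lambda>x. indicator cube x *\<^sub>R ((\<Prod>j\<in>UNIV. poly (P j) (x $ j)) * mweight lam n x))"
  proof
    fix x :: "real ^ 'n"
    show "(\<Prod>j\<in>UNIV. h j (x $ j)) =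
      indicator cube x *\<^sub>R ((\<Prod>j\<in>UNIV. poly (P j) (x $ j)) * mweight lam n x)"
    proof (cases "x \<in> cube")
      case True
      then have "x $ j \<in> {-1..1}" for j by (simp add: mem_cube abs_le_iff_between)
      then show ?thesis using True by (simp only: h_def mweight_def indicator_simps scaleR_one prod.distrib)
    next
      case False
      then obtain j where "\<bar>x $ j\<bar> > 1" by (auto simp: mem_cube not_le)
      then have "x $ j \<notin> {-1..1}" by auto
      then have "h j (x $ j) = 0" by (simp add: h_def)
      then have "(\<Prod>j\<in>UNIV. h j (x $ j)) = 0" by (intro prod_zero) auto
      then show ?thesis using False by simp
    qed
  qed
  have meas: "(\<lambda>x::real ^ 'n. \<Prod>j\<in>UNIV. h j (x $ j)) \<in> borel_measurable lborel"
    using integral_prod_vec_nth(1)[OF int] by (rule borel_measurable_integrable)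
  show "set_integrable lebesgue cube (\<lambda>x. (\<Prod>j\<in>UNIV. poly (P j) (x $ j)) * mweight lam n x)"
    unfolding set_integrable_def eq[symmetric]
    using integral_prod_vec_nth(1)[OF int] meas by (simp add: integrable_completion)
  have "(LINT x:cube|lebesgue. (\<Prod>j\<in>UNIV. poly (P j) (x $ j)) * mweight lam n x) =
      (LINT x|lborel. (\<Prod>j\<in>UNIV. h j ((x::real ^ 'n) $ j)))"
    unfolding set_lebesgue_integral_def eq[symmetric] using meas by (rule integral_completion)
  also have "\<dots> = (\<Prod>j\<in>UNIV. (LINT t|lborel. h j t))"
    by (rule integral_prod_vec_nth(2)[OF int])
  also have "\<dots> = (\<Prod>j\<in>UNIV. weighted_integral (lam + real (n j)) (P j))"
    unfolding weighted_integral_def set_lebesgue_integral_def h_def[symmetric]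
    using h_meas by (simp add: integral_completion)
  finally show "(LINT x:cube|lebesgue. (\<Prod>j\<in>UNIV. poly (P j) (x $ j)) * mweight lam n x) =
      (\<Prod>j\<in>UNIV. weighted_integral (lam + real (n j)) (P j))" .
qed

lemma Cauchy_Schwarz_integral:
  fixes A B :: "'a \<Rightarrow> real"
  assumes [measurable]: "A \<in> borel_measurable M" "B \<in> borel_measurable M"
    and int: "integrable M (\<lambda>x. (A x)\<^sup>2)" "integrable M (\<lambda>x. (B x)\<^sup>2)"
  shows "integrable M (\<lambda>x. A x * B x)"
    and "\<bar>LINT x|M. A x * B x\<bar> \<le> sqrt (LINT x|M. (A x)\<^sup>2) * sqrt (LINT x|M. (B x)\<^sup>2)"
proof -
  show AB: "integrable M (\<lambda>x. A x * B x)"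
  proof (rule Bochner_Integration.integrable_bound)
    show "integrable M (\<lambda>x. (A x)\<^sup>2 + (B x)\<^sup>2)" using int by simp
    have "\<bar>a * b\<bar> \<le> a\<^sup>2 + b\<^sup>2" for a b :: real
    proof -
      have "0 \<le> \<bar>a\<bar> * \<bar>b\<bar>" by simp
      then show ?thesis
        using sum_squares_bound[of "\<bar>a\<bar>" "\<bar>b\<bar>"] unfolding abs_mult power2_abs mult.assoc by linarith
    qed
    then show "AE x in M. norm (A x * B x) \<le> norm ((A x)\<^sup>2 + (B x)\<^sup>2)" by simp
  qed measurable
  define a b c where "a = (LINT x|M. (A x)\<^sup>2)" "b = (LINT x|M. (B x)\<^sup>2)" "c = (LINT x|M. A x * B x)"
  note defs = this
  have nn: "a \<ge> 0" "b \<ge> 0" by (simp_all add: defs)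
  have quad: "0 \<le> a - 2 * t * c + t\<^sup>2 * b" for t
  proof -
    have "0 \<le> (LINT x|M. (A x - t * B x)\<^sup>2)" by simp
    also have "(\<lambda>x. (A x - t * B x)\<^sup>2) = (\<lambda>x. (A x)\<^sup>2 - 2 * t * (A x * B x) + t\<^sup>2 * (B x)\<^sup>2)"
      by (rule ext) (simp add: power2_eq_square algebra_simps)
    also have "(LINT x|M. (A x)\<^sup>2 - 2 * t * (A x * B x) + t\<^sup>2 * (B x)\<^sup>2) = a - 2 * t * c + t\<^sup>2 * b"
      using int AB by (simp add: defs)
    finally show ?thesis .
  qed
  have "c\<^sup>2 \<le> a * b"
  proof (cases "b = 0")
    case True
    have "c = 0"
    proof (rule ccontr)
      assume "c \<noteq> 0"
      \<comment> \<open>At this value of \<open>t\<close>, with \<open>b = 0\<close>, the quadratic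
        equals \<open>-1\<close>.\<close>
      then show False using quad[of "(a + 1) / (2 * c)"] True by simp
    qed
    then show ?thesis using True by simp
  next
    case False
    \<comment> \<open>The value \<open>t = c / b\<close> minimizes the quadratic.\<close>
    then have "a - c\<^sup>2 / b \<ge> 0" using quad[of "c / b"] by (simp add: power2_eq_square)
    then show ?thesis using False nn by (simp add: field_simps)
  qed
  then have "sqrt (c\<^sup>2) \<le> sqrt (a * b)" by (rule real_sqrt_le_mono)
  then show "\<bar>LINT x|M. A x * B x\<bar> \<le> sqrt (LINT x|M. (A x)\<^sup>2) * sqrt (LINT x|M. (B x)\<^sup>2)"
    by (simp add: real_sqrt_mult flip: defs)
qed

section \<open>Weights and measurability on the open and the closed cube\<close>

lemma mweight_nonneg: "mweight lam n x \<ge> 0"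
  unfolding mweight_def by (intro prod_nonneg ballI gegenbauer_weight_nonneg)

lemma borel_measurable_mweight [measurable]: "mweight lam n \<in> borel_measurable borel"
  unfolding mweight_def[abs_def] by measurable

lemma mweight_boundary_0:
  assumes "x \<in> cube" "x \<notin> interior cube"
  shows "mweight lam n x = 0"
proof -
  obtain j where "\<not> \<bar>x $ j\<bar> < 1" using assms(2) by (auto simp: mem_interior_cube)
  moreover have "\<bar>x $ j\<bar> \<le> 1" using assms(1) by (simp add: mem_cube)
  ultimately have "\<bar>x $ j\<bar> = 1" by simp
  then have "(x $ j)\<^sup>2 = 1" by (simp add: abs_square_eq_1)
  \<comment> \<open>In HOL \<open>0 powr r = 0\<close> for every \<open>r\<close>, so the weight is
    zero on the boundary even where the exponent is negative or zero.\<close>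
  then show ?thesis by (auto simp: mweight_def gegenbauer_weight_def intro!: bexI[of _ j])
qed

text \<open>Links the coefficients, which are integrals over the closed cube, with distributional
  derivatives, which live on the open cube. The integrands agree at every point.\<close>

lemma indicator_cube_mweight:
  "indicator cube x *\<^sub>R (F * mweight lam n x) = indicator (interior cube) x *\<^sub>R (F * mweight lam n x)"
proof (cases "x \<in> interior cube")
  case True
  then have "x \<in> cube" using interior_subset by blast
  with True show ?thesis by simp
next
  case False
  then show ?thesis by (cases "x \<in> cube") (simp_all add: mweight_boundary_0)
qed

text \<open>Local integrability gives measurability on each compact subcube of half-width
  \<open>1 - 1 / (i + 1)\<close>. These exhaust the open cube, and pointwise limits of measurable
  functions are measurable.\<close>

lemma locally_integrable_borel_measurable:
  fixes g :: "real ^ 'n \<Rightarrow> real"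
  assumes "locally_integrable (interior cube) g"
  shows "(\<lambda>x. indicator (interior cube) x *\<^sub>R g x) \<in> borel_measurable lebesgue"
proof (rule borel_measurable_LIMSEQ_real)
  define K :: "nat \<Rightarrow> (real ^ 'n) set" where
    "K i = cbox (\<chi> j. - (1 - 1 / real (Suc i))) (\<chi> j. 1 - 1 / real (Suc i))"
    for i :: nat
  have K: "x \<in> K i \<longleftrightarrow> (\<forall>j. \<bar>x $ j\<bar> \<le> 1 - 1 / real (Suc i))" for x i
    unfolding K_def mem_box_cart abs_le_iff_between by simp
  have K_sub: "K i \<subseteq> interior cube" for i
  proof
    fix x assume "x \<in> K i"
    then have "\<bar>x $ j\<bar> \<le> 1 - 1 / real (Suc i)" for j by (simp only: K)
    moreover have "1 - 1 / real (Suc i) < 1" by simp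
    ultimately show "x \<in> interior cube" unfolding mem_interior_cube by (meson le_less_trans)
  qed
  show "(\<lambda>x. indicator (K i) x *\<^sub>R g x) \<in> borel_measurable lebesgue" for i
  proof -
    have "set_integrable lebesgue (K i) g"
      using assms K_sub by (auto simp: locally_integrable_def K_def)
    then show ?thesis unfolding set_integrable_def by (rule borel_measurable_integrable)
  qed
  show "(\<lambda>i. indicator (K i) x *\<^sub>R g x) \<longlonglongrightarrow> indicator (interior cube) x *\<^sub>R g x" for x
  proof (cases "x \<in> interior cube")
    case True
    have lim: "(\<lambda>i. 1 / real (Suc i)) \<longlonglongrightarrow> 0"
      using LIMSEQ_inverse_real_of_nat by (simp add: inverse_eq_divide)
    have "\<forall>\<^sub>F i in sequentially. \<forall>j\<in>UNIV. 1 / real (Suc i) < 1 - \<bar>x $ j\<bar>"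
      using True by (intro eventually_ball_finite ballI order_tendstoD(2)[OF lim]) (auto simp: mem_interior_cube)
    then have "\<forall>\<^sub>F i in sequentially. indicator (K i) x *\<^sub>R g x = indicator (interior cube) x *\<^sub>R g x"
    proof eventually_elim
      case (elim i)
      have "\<bar>x $ j\<bar> \<le> 1 - 1 / real (Suc i)" for j
        using bspec[OF elim UNIV_I, of j] by linarith
      then have "x \<in> K i" unfolding K by blast
      then show ?case using True by simp
    qed
    then show ?thesis by (rule tendsto_eventually)
  next
    case False
    then have "x \<notin> K i" for i using K_sub by blast
    then show ?thesis using False by simp
  qed
qed

section \<open>Integration by parts and the coefficient bound\<close>

lemma borel_measurable_cutoff_fun:
  assumes "e > 0"
  shows "cutoff_fun e a Q \<in> borel_measurable borel"
  by (intro borel_measurable_continuous_onI continuous_at_imp_continuous_on ballI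
      DERIV_isCont[OF has_real_derivative_cutoff_fun[OF assms]])

text \<open>The product of the one-dimensional constants works; like them it is independent of
  \<open>e\<close>.\<close>

lemma prod_cutoff_fun_bounded:
  fixes n :: "'n::finite \<Rightarrow> nat"
  shows "\<exists>K\<ge>0. \<forall>e>0. \<forall>x\<in>interior cube.
    \<bar>\<Prod>j\<in>UNIV. cutoff_fun e (lam + real (n j) - 1/2) (Q j) (x $ j)\<bar> \<le> K * mweight lam n x"
proof -
  have "\<exists>K. \<forall>j. K j \<ge> 0 \<and> (\<forall>e>0. \<forall>t. \<bar>t\<bar> \<le> 1 \<longrightarrow>
      \<bar>cutoff_fun e (lam + real (n j) - 1/2) (Q j) t\<bar> \<le> K j * (1 - t\<^sup>2) powr (lam + real (n j) - 1/2))"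
    by (intro choice allI cutoff_fun_bounded)
  then obtain K where K: "\<And>j. K j \<ge> 0" "\<And>j e t. e > 0 \<Longrightarrow> \<bar>t\<bar> \<le> 1 \<Longrightarrow>
      \<bar>cutoff_fun e (lam + real (n j) - 1/2) (Q j) t\<bar> \<le> K j * (1 - t\<^sup>2) powr (lam + real (n j) - 1/2)"
    by blast
  have "\<bar>\<Prod>j\<in>UNIV. cutoff_fun e (lam + real (n j) - 1/2) (Q j) (x $ j)\<bar> \<le> (\<Prod>j\<in>UNIV. K j) * mweight lam n x"
    if "e > 0" "x \<in> interior cube" for e x
  proof -
    have "\<bar>x $ j\<bar> \<le> 1" for j
      using that(2) by (simp add: mem_interior_cube less_imp_le)
    then show ?thesis
      unfolding mweight_def gegenbauer_weight_def abs_prod prod.distrib[symmetric]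
      using K that by (intro prod_mono) auto
  qed
  moreover have "(\<Prod>j\<in>UNIV. K j) \<ge> 0" using K(1) by (simp add: prod_nonneg)
  ultimately show ?thesis by blast
qed

lemma prod_cutoff_fun_tendsto:
  fixes n :: "'n::finite \<Rightarrow> nat"
  assumes "x \<in> interior cube"
  shows "(\<lambda>i. \<Prod>j\<in>UNIV. cutoff_fun (1 / real (Suc i)) (lam + real (n j) - 1/2) (Q j) (x $ j))
    \<longlonglongrightarrow> (\<Prod>j\<in>UNIV. poly (coeff (Q j) 0) (x $ j)) * mweight lam n x"
  unfolding mweight_def gegenbauer_weight_def prod.distrib[symmetric]
  using assms by (intro tendsto_prod cutoff_fun_tendsto) (simp add: mem_interior_cube)

text \<open>Dominated convergence with the majorant
  \<open>K * \<bar>F x * mweight lam n x\<bar>\<close> on the open cube, where \<open>K\<close> is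
  the uniform constant for the cut-off products.\<close>

lemma integral_prod_cutoff_fun_tendsto:
  fixes n :: "'n::finite \<Rightarrow> nat" and F :: "real ^ 'n \<Rightarrow> real"
  assumes meas: "(\<lambda>x. indicator (interior cube) x *\<^sub>R F x) \<in> borel_measurable lebesgue"
    and int: "set_integrable lebesgue (interior cube) (\<lambda>x. F x * mweight lam n x)"
  shows "(\<lambda>i. LINT x:interior cube|lebesgue.
        F x * (\<Prod>j\<in>UNIV. cutoff_fun (1 / real (Suc i)) (lam + real (n j) - 1/2) (Q j) (x $ j)))
    \<longlonglongrightarrow> (LINT x:interior cube|lebesgue.
        F x * ((\<Prod>j\<in>UNIV. poly (coeff (Q j) 0) (x $ j)) * mweight lam n x))"
proof -
  define \<Phi> where "\<Phi> i x = (\<Prod>j\<in>UNIV. cutoff_fun (1 / real (Suc i)) (lam + real (n j) - 1/2) (Q j) (x $ j))"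
    for i :: nat and x :: "real ^ 'n"
  define \<Psi> where "\<Psi> x = (\<Prod>j\<in>UNIV. poly (coeff (Q j) 0) (x $ j)) * mweight lam n x" for x :: "real ^ 'n"
  obtain K where K: "K \<ge> 0" "\<And>i x. x \<in> interior cube \<Longrightarrow> \<bar>\<Phi> i x\<bar> \<le> K * mweight lam n x"
    using prod_cutoff_fun_bounded[of lam n Q] unfolding \<Phi>_def
    by (meson of_nat_0_less_iff zero_less_Suc zero_less_divide_1_iff)
  have \<Phi>_meas: "\<Phi> i \<in> borel_measurable lebesgue" for i
  proof -
    have [measurable]: "cutoff_fun (1 / real (Suc i)) (lam + real (n j) - 1/2) (Q j) \<in> borel_measurable borel" for j
      by (rule borel_measurable_cutoff_fun) simp
    have "\<Phi> i \<in> borel_measurable borel" unfolding \<Phi>_def by measurable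
    then show ?thesis by (simp add: measurable_completion)
  qed
  have \<Phi>_lim: "(\<lambda>i. \<Phi> i x) \<longlonglongrightarrow> \<Psi> x" if "x \<in> interior cube" for x
    unfolding \<Phi>_def \<Psi>_def by (rule prod_cutoff_fun_tendsto[OF that])
  let ?s = "\<lambda>i x. indicator (interior cube) x *\<^sub>R F x * \<Phi> i x"
  let ?f = "\<lambda>x. indicator (interior cube) x *\<^sub>R F x * \<Psi> x"
  have lim: "(\<lambda>i. ?s i x) \<longlonglongrightarrow> ?f x" for x
    by (cases "x \<in> interior cube") (auto intro: tendsto_mult_left \<Phi>_lim)
  have s_meas: "?s i \<in> borel_measurable lebesgue" for i
    by (intro borel_measurable_times meas \<Phi>_meas)
  have "(\<lambda>i. integral\<^sup>L lebesgue (?s i)) \<longlonglongrightarrow> integral\<^sup>L lebesgue ?f"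
  proof (rule integral_dominated_convergence)
    show "?f \<in> borel_measurable lebesgue" by (rule borel_measurable_LIMSEQ_real[OF lim s_meas])
    show "integrable lebesgue (\<lambda>x. K * norm (indicator (interior cube) x *\<^sub>R (F x * mweight lam n x)))"
      using int unfolding set_integrable_def by (intro integrable_mult_right integrable_norm)
    show "AE x in lebesgue. norm (?s i x) \<le> K * norm (indicator (interior cube) x *\<^sub>R (F x * mweight lam n x))" for i
    proof (rule AE_I2)
      fix x :: "real ^ 'n"
      show "norm (?s i x) \<le> K * norm (indicator (interior cube) x *\<^sub>R (F x * mweight lam n x))"
      proof (cases "x \<in> interior cube")
        case True
        have "\<bar>F x\<bar> * \<bar>\<Phi> i x\<bar> \<le> \<bar>F x\<bar> * (K * mweight lam n x)"
          by (intro mult_left_mono K True) simp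
        then show ?thesis using True mweight_nonneg[of lam n x] by (simp add: abs_mult mult_ac)
      qed simp
    qed
  qed (use lim s_meas in auto)
  then show ?thesis
    unfolding \<Phi>_def[symmetric] \<Psi>_def[symmetric] set_lebesgue_integral_def
    by (simp add: mult.assoc)
qed

lemma set_integrable_interior_cube_mweight:
  "set_integrable lebesgue cube (\<lambda>x. F x * mweight lam n x) \<longleftrightarrow>
   set_integrable lebesgue (interior cube) (\<lambda>x. F x * mweight lam n x)"
  unfolding set_integrable_def indicator_cube_mweight ..

lemma set_integral_interior_cube_mweight:
  "(LINT x:cube|lebesgue. F x * mweight lam n x) = (LINT x:interior cube|lebesgue. F x * mweight lam n x)"
  unfolding set_lebesgue_integral_def indicator_cube_mweight ..

lemma continuous_on_interior_cube_measurable: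
  fixes f :: "real ^ 'n \<Rightarrow> real"
  assumes "continuous_on cube f"
  shows "(\<lambda>x. indicator (interior cube) x *\<^sub>R f x) \<in> borel_measurable lebesgue"
proof -
  have "continuous_on (interior cube) f"
    using assms interior_subset by (rule continuous_on_subset)
  then have "(\<lambda>x. indicator (interior cube) x *\<^sub>R f x) \<in> borel_measurable borel"
    by (intro borel_measurable_continuous_on_indicator) auto
  then show ?thesis by (simp add: measurable_completion)
qed

lemma set_integrable_continuous_mweight:
  fixes f :: "real ^ 'n \<Rightarrow> real"
  assumes "lam > 0" "continuous_on cube f"
  shows "set_integrable lebesgue (interior cube) (\<lambda>x. f x * mweight lam n x)"
proof -
  have "compact (f ` cube)"
    using assms(2) unfolding cube_def by (rule compact_continuous_image) simp
  then obtain B where B: "\<And>x. x \<in> cube \<Longrightarrow> \<bar>f x\<bar> \<le> B"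
    using compact_imp_bounded bounded_iff by (metis imageI real_norm_def)
  have 1: "set_integrable lebesgue (interior cube) (\<lambda>x. 1 * mweight lam n x)"
    using integral_prod_poly_weight(1)[OF assms(1), of "\<lambda>_. 1" n]
    unfolding set_integrable_interior_cube_mweight by simp
  have "integrable lebesgue (\<lambda>x. indicator (interior cube) x *\<^sub>R f x * mweight lam n x)"
  proof (rule Bochner_Integration.integrable_bound)
    show "integrable lebesgue (\<lambda>x. B * (indicator (interior cube) x *\<^sub>R (1 * mweight lam n x)))"
      using 1 unfolding set_integrable_def by (rule integrable_mult_right)
    have "mweight lam n \<in> borel_measurable lebesgue" by (simp add: measurable_completion)
    then show "(\<lambda>x. indicator (interior cube) x *\<^sub>R f x * mweight lam n x) \<in> borel_measurable lebesgue"
      by (intro borel_measurable_times continuous_on_interior_cube_measurable assms)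
    show "AE x in lebesgue. norm (indicator (interior cube) x *\<^sub>R f x * mweight lam n x)
        \<le> norm (B * (indicator (interior cube) x *\<^sub>R (1 * mweight lam n x)))"
    proof (rule AE_I2)
      fix x :: "real ^ 'n"
      show "norm (indicator (interior cube) x *\<^sub>R f x * mweight lam n x)
        \<le> norm (B * (indicator (interior cube) x *\<^sub>R (1 * mweight lam n x)))"
      proof (cases "x \<in> interior cube")
        case True
        then have "x \<in> cube" using interior_subset by blast
        then have "\<bar>f x\<bar> \<le> \<bar>B\<bar>" using B[of x] by linarith
        then show ?thesis
          using True mweight_nonneg[of lam n x] by (simp add: abs_mult mult_right_mono)
      qed simp
    qed
  qed
  then show ?thesis by (simp add: set_integrable_def mult.assoc)
qed

text \<open>The definition of the distributional derivative is tested against cut-off products with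
  \<open>e = 1 / (i + 1)\<close>, and both sides are passed to the limit. On the left the
  derivatives have lowered the weight parameter from \<open>lam + p\<close> to \<open>lam\<close>;
  on the right it is unchanged.\<close>

lemma distr_deriv_integration_by_parts:
  fixes f g :: "real ^ 'n::finite \<Rightarrow> real" and p :: "'n \<Rightarrow> nat" and P :: "'n \<Rightarrow> real poly"
  assumes lam: "lam > 0" and cont: "continuous_on cube f" and der: "has_distr_deriv f p g"
    and int: "set_integrable lebesgue (interior cube) (\<lambda>x. g x * mweight lam p x)"
  defines "R \<equiv> \<lambda>j. coeff (cutoff_iter (lam + real (p j) - 1/2) [:P j:] (p j)) 0"
  shows "(LINT x:interior cube|lebesgue.
        f x * ((\<Prod>j\<in>UNIV. poly (R j) (x $ j)) * mweight lam (\<lambda>_. 0) x)) =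
      (-1) ^ (\<Sum>i\<in>UNIV. p i) * (LINT x:interior cube|lebesgue.
        g x * ((\<Prod>j\<in>UNIV. poly (P j) (x $ j)) * mweight lam p x))"
proof -
  \<comment> \<open>The \<open>n\<close>-th derivative of the factor in direction \<open>j\<close>
    of the test function with index \<open>i\<close>.\<close>
  define D where "D i j n = cutoff_fun (1 / real (Suc i)) (lam + real (p j) - 1/2 - real n)
      (cutoff_iter (lam + real (p j) - 1/2) [:P j:] n)" for i j n
  have D_deriv: "(D i j n has_real_derivative D i j (Suc n) t) (at t)" for i j n t
    unfolding D_def by (rule has_real_derivative_cutoff_iter) simp
  have test: "test_function (interior cube) (\<lambda>x::real ^ 'n. \<Prod>j\<in>UNIV. D i j 0 (x $ j))" for i
  proof (rule test_function_prod)
    \<comment> \<open>For \<open>\<bar>t\<bar> > r\<close> one has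
      \<open>1 - t^2 < 1 / (i + 1)\<close>, so the factor is cut off. For \<open>i = 0\<close> this
      gives \<open>r = 0\<close> and the test function is zero.\<close>
    define r where "r = sqrt (1 - 1 / real (Suc i))"
    have r2: "r\<^sup>2 = 1 - 1 / real (Suc i)" "r \<ge> 0" by (simp_all add: r_def)
    show "r < 1" unfolding r_def by simp
    show "D i j 0 t = 0" if "r < \<bar>t\<bar>" for j t
    proof -
      have "r\<^sup>2 < \<bar>t\<bar>\<^sup>2" using that r2(2) by (intro power_strict_mono) auto
      then show ?thesis using r2(1) by (simp add: D_def cutoff_fun_def del: of_nat_Suc)
    qed
  qed (rule D_deriv)
  have eq: "(LINT x:interior cube|lebesgue. f x * (\<Prod>j\<in>UNIV. D i j (p j) (x $ j))) =
      (-1) ^ (\<Sum>i\<in>UNIV. p i) * (LINT x:interior cube|lebesgue. g x * (\<Prod>j\<in>UNIV. D i j 0 (x $ j)))" for i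
  proof -
    have "(LINT x:interior cube|lebesgue. f x * multi_deriv p (\<lambda>x. \<Prod>j\<in>UNIV. D i j 0 (x $ j)) x) =
      (-1) ^ (\<Sum>i\<in>UNIV. p i) * (LINT x:interior cube|lebesgue. g x * (\<Prod>j\<in>UNIV. D i j 0 (x $ j)))"
      using der[unfolded has_distr_deriv_def, THEN conjunct2, THEN conjunct2, THEN spec, THEN mp, OF test] .
    then show ?thesis by (simp only: multi_deriv_prod[of "D i", OF D_deriv])
  qed
  have "(\<lambda>i. LINT x:interior cube|lebesgue. f x * (\<Prod>j\<in>UNIV. D i j (p j) (x $ j))) \<longlonglongrightarrow>
      (LINT x:interior cube|lebesgue. f x * ((\<Prod>j\<in>UNIV. poly (R j) (x $ j)) * mweight lam (\<lambda>_. 0) x))"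
    using integral_prod_cutoff_fun_tendsto[OF continuous_on_interior_cube_measurable[OF cont]
        set_integrable_continuous_mweight[OF lam cont, of "\<lambda>_. 0"]]
    by (simp add: D_def R_def algebra_simps)
  moreover have "(\<lambda>i. (-1) ^ (\<Sum>i\<in>UNIV. p i) *
        (LINT x:interior cube|lebesgue. g x * (\<Prod>j\<in>UNIV. D i j 0 (x $ j)))) \<longlonglongrightarrow>
      (-1) ^ (\<Sum>i\<in>UNIV. p i) *
        (LINT x:interior cube|lebesgue. g x * ((\<Prod>j\<in>UNIV. poly (P j) (x $ j)) * mweight lam p x))"
    using integral_prod_cutoff_fun_tendsto[OF locally_integrable_borel_measurable int, of "\<lambda>j. [:P j:]"] der
    by (intro tendsto_mult_left) (simp add: D_def has_distr_deriv_def)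
  ultimately show ?thesis
    unfolding eq by (rule LIMSEQ_unique)
qed

lemma sqrt_prod: "sqrt (\<Prod>i\<in>A. h i) = (\<Prod>i\<in>A. sqrt (h i))"
  by (induction A rule: infinite_finite_induct) (simp_all add: real_sqrt_mult)

text \<open>The weight is split into two square roots, one attached to \<open>g\<close> and one to
  the polynomial product. The square integral of the latter factors over the coordinates.\<close>

lemma weighted_Cauchy_Schwarz:
  fixes g :: "real ^ 'n::finite \<Rightarrow> real" and P :: "'n \<Rightarrow> real poly"
  assumes lam: "lam > 0"
    and meas: "(\<lambda>x. indicator (interior cube) x *\<^sub>R g x) \<in> borel_measurable lebesgue"
    and int: "set_integrable lebesgue cube (\<lambda>x. \<bar>g x\<bar>\<^sup>2 * mweight lam p x)"
  shows "set_integrable lebesgue (interior cube) (\<lambda>x. g x * ((\<Prod>j\<in>UNIV. poly (P j) (x $ j)) * mweight lam p x))"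
    and "\<bar>LINT x:interior cube|lebesgue. g x * ((\<Prod>j\<in>UNIV. poly (P j) (x $ j)) * mweight lam p x)\<bar> \<le>
      sqrt (LINT x:cube|lebesgue. \<bar>g x\<bar>\<^sup>2 * mweight lam p x) *
      (\<Prod>j\<in>UNIV. sqrt (weighted_integral (lam + real (p j)) (P j * P j)))"
proof -
  define Q where "Q x = (\<Prod>j\<in>UNIV. poly (P j) (x $ j))" for x :: "real ^ 'n"
  define A where "A x = indicator (interior cube) x *\<^sub>R g x * sqrt (mweight lam p x)" for x
  define B where "B x = indicator (interior cube) x *\<^sub>R (Q x * sqrt (mweight lam p x))" for x :: "real ^ 'n"
  have sqrt_w: "sqrt (mweight lam p x) * sqrt (mweight lam p x) = mweight lam p x" for x :: "real ^ 'n"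
    by (simp add: mweight_nonneg)
  have A2: "(A x)\<^sup>2 = indicator cube x *\<^sub>R (\<bar>g x\<bar>\<^sup>2 * mweight lam p x)" for x
    unfolding indicator_cube_mweight
    by (cases "x \<in> interior cube") (simp_all add: A_def power_mult_distrib mweight_nonneg)
  have B2: "(B x)\<^sup>2 = indicator cube x *\<^sub>R ((\<Prod>j\<in>UNIV. poly (P j * P j) (x $ j)) * mweight lam p x)" for x
    unfolding indicator_cube_mweight
    by (cases "x \<in> interior cube")
      (simp_all add: B_def Q_def power_mult_distrib mweight_nonneg power2_eq_square prod.distrib)
  have AB: "A x * B x = indicator (interior cube) x *\<^sub>R (g x * (Q x * mweight lam p x))" for x
    using sqrt_w[of x] by (cases "x \<in> interior cube") (simp_all add: A_def B_def mult_ac)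
  have [measurable]: "poly (P j) \<in> borel_measurable borel" for j
    by (intro borel_measurable_continuous_onI continuous_intros)
  have w_meas: "(\<lambda>x::real ^ 'n. sqrt (mweight lam p x)) \<in> borel_measurable borel" by measurable
  have "A \<in> borel_measurable lebesgue"
    unfolding A_def[abs_def] using w_meas
    by (intro borel_measurable_times meas) (simp add: measurable_completion)
  moreover have "B \<in> borel_measurable borel"
    unfolding B_def[abs_def] Q_def[abs_def] by measurable
  then have "B \<in> borel_measurable lebesgue" by (simp add: measurable_completion)
  moreover have "integrable lebesgue (\<lambda>x. (A x)\<^sup>2)"
    using int by (simp only: A2 set_integrable_def)
  moreover have "integrable lebesgue (\<lambda>x. (B x)\<^sup>2)"
    using integral_prod_poly_weight(1)[OF lam, of "\<lambda>j. P j * P j" p] by (simp only: B2 set_integrable_def)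
  ultimately have CS: "integrable lebesgue (\<lambda>x. A x * B x)"
    "\<bar>LINT x|lebesgue. A x * B x\<bar> \<le> sqrt (LINT x|lebesgue. (A x)\<^sup>2) * sqrt (LINT x|lebesgue. (B x)\<^sup>2)"
    using Cauchy_Schwarz_integral[of A lebesgue B] by auto
  show "set_integrable lebesgue (interior cube) (\<lambda>x. g x * ((\<Prod>j\<in>UNIV. poly (P j) (x $ j)) * mweight lam p x))"
    using CS(1) by (simp only: AB set_integrable_def Q_def)
  have "(LINT x|lebesgue. (A x)\<^sup>2) = (LINT x:cube|lebesgue. \<bar>g x\<bar>\<^sup>2 * mweight lam p x)"
    by (simp only: A2 set_lebesgue_integral_def)
  moreover have "(LINT x|lebesgue. (B x)\<^sup>2) = (\<Prod>j\<in>UNIV. weighted_integral (lam + real (p j)) (P j * P j))"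
    using integral_prod_poly_weight(2)[OF lam, of "\<lambda>j. P j * P j" p] by (simp only: B2 set_lebesgue_integral_def)
  ultimately show "\<bar>LINT x:interior cube|lebesgue. g x * ((\<Prod>j\<in>UNIV. poly (P j) (x $ j)) * mweight lam p x)\<bar> \<le>
      sqrt (LINT x:cube|lebesgue. \<bar>g x\<bar>\<^sup>2 * mweight lam p x) *
      (\<Prod>j\<in>UNIV. sqrt (weighted_integral (lam + real (p j)) (P j * P j)))"
    using CS(2) by (simp only: AB set_lebesgue_integral_def Q_def sqrt_prod)
qed

text \<open>Taking \<open>P j\<close> as the Gegenbauer polynomial of parameter
  \<open>lam + p j\<close> and degree \<open>k j - p j\<close> makes integration by parts reproduce,
  up to sign and the constants \<open>c j\<close>, the integral that defines the coefficient. The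
  Cauchy-Schwarz inequality then bounds the other side.\<close>

lemma gegenbauer_coeff_bound:
  fixes f g :: "real ^ 'n::finite \<Rightarrow> real" and p k :: "'n \<Rightarrow> nat"
  assumes lam: "lam > 0" and pk: "p \<le> k" and cont: "continuous_on cube f"
    and der: "has_distr_deriv f p g"
    and int: "set_integrable lebesgue cube (\<lambda>x. \<bar>g x\<bar>\<^sup>2 * mweight lam p x)"
  shows "\<bar>LINT x:cube|lebesgue. f x * mgegenbauer lam k x * mweight lam (\<lambda>_. 0) x\<bar> \<le>
    sqrt (LINT x:cube|lebesgue. \<bar>g x\<bar>\<^sup>2 * mweight lam p x) *
    (\<Prod>j\<in>UNIV. sqrt (gegenbauer_norm (lam + real (p j)) (k j - p j)) *
      (\<Prod>s<p j. 2 * (lam + real s) / ((real (k j) - real s) * (real (k j) + 2 * lam + real s))))"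
proof -
  \<comment> \<open>The Rodrigues factor up to sign; its reciprocal is the factor in the asserted
    bound.\<close>
  define \<rho> where "\<rho> j s = (real (k j) - real s) * (real (k j) + 2 * lam + real s) / (2 * (lam + real s))" for j s
  define c where "c j = (\<Prod>s<p j. \<rho> j s)" for j
  have \<rho>: "\<rho> j s > 0" if "s < p j" for j s
  proof -
    have "p j \<le> k j" using pk by (simp add: le_fun_def)
    then show ?thesis using that lam by (auto simp: \<rho>_def intro!: divide_pos_pos mult_pos_pos)
  qed
  have c: "c j > 0" for j using \<rho> by (auto simp: c_def intro: prod_pos)
  have c_inv: "1 / c j = (\<Prod>s<p j. 2 * (lam + real s) / ((real (k j) - real s) * (real (k j) + 2 * lam + real s)))" for j
  proof -
    have "1 / c j = (\<Prod>s<p j. 1 / \<rho> j s)" by (simp add: c_def prod_dividef)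
    then show ?thesis by (simp add: \<rho>_def)
  qed
  define P where "P j = gegenbauer (lam + real (p j)) (k j - p j)" for j
  have meas: "(\<lambda>x. indicator (interior cube) x *\<^sub>R g x) \<in> borel_measurable lebesgue"
    using der by (intro locally_integrable_borel_measurable) (simp add: has_distr_deriv_def)
  \<comment> \<open>Square integrability gives integrability against the weight: the case of the
    constant polynomials \<open>1\<close>.\<close>
  have gint: "set_integrable lebesgue (interior cube) (\<lambda>x. g x * mweight lam p x)"
    using weighted_Cauchy_Schwarz(1)[OF lam meas int, of "\<lambda>_. 1"] by simp
  have R: "coeff (cutoff_iter (lam + real (p j) - 1/2) [:P j:] (p j)) 0 =
      smult ((-1) ^ p j * c j) (gegenbauer lam (k j))" for j
    using cutoff_iter_gegenbauer[OF lam order_refl, of "p j" "k j"] pk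
    by (simp add: P_def c_def \<rho>_def le_fun_def prod_uminus atLeast0LessThan)
  define J where "J = (LINT x:cube|lebesgue. f x * mgegenbauer lam k x * mweight lam (\<lambda>_. 0) x)"
  define G where "G = (LINT x:interior cube|lebesgue. g x * ((\<Prod>j\<in>UNIV. poly (P j) (x $ j)) * mweight lam p x))"
  have "(\<Prod>j\<in>UNIV. (-1) ^ p j * c j) * J = (-1) ^ (\<Sum>i\<in>UNIV. p i) * G"
  proof -
    have "(\<Prod>j\<in>UNIV. (-1) ^ p j * c j) * J = (LINT x:interior cube|lebesgue.
        (\<Prod>j\<in>UNIV. (-1) ^ p j * c j) * (f x * mgegenbauer lam k x * mweight lam (\<lambda>_. 0) x))"
      unfolding J_def set_integral_interior_cube_mweight by simp
    also have "\<dots> = (LINT x:interior cube|lebesgue.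
        f x * ((\<Prod>j\<in>UNIV. poly (smult ((-1) ^ p j * c j) (gegenbauer lam (k j))) (x $ j)) * mweight lam (\<lambda>_. 0) x))"
      by (simp only: poly_smult prod.distrib mgegenbauer_def mult_ac)
    also have "\<dots> = (-1) ^ (\<Sum>i\<in>UNIV. p i) * G"
      unfolding G_def R[symmetric] by (rule distr_deriv_integration_by_parts[OF lam cont der gint])
    finally show ?thesis .
  qed
  then have "\<bar>(\<Prod>j\<in>UNIV. (-1) ^ p j * c j) * J\<bar> = \<bar>(-1) ^ (\<Sum>i\<in>UNIV. p i) * G\<bar>" by simp
  then have CJ: "\<bar>G\<bar> = (\<Prod>j\<in>UNIV. c j) * \<bar>J\<bar>"
    using c by (simp add: abs_mult abs_prod power_abs abs_of_pos)
  have "(\<Prod>j\<in>UNIV. c j) \<noteq> 0" using c by (simp add: less_imp_neq[symmetric])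
  then have "\<bar>J\<bar> = \<bar>G\<bar> * (\<Prod>j\<in>UNIV. 1 / c j)"
    unfolding CJ by (simp add: prod_dividef)
  also have "\<dots> \<le> (sqrt (LINT x:cube|lebesgue. \<bar>g x\<bar>\<^sup>2 * mweight lam p x) *
      (\<Prod>j\<in>UNIV. sqrt (weighted_integral (lam + real (p j)) (P j * P j)))) * (\<Prod>j\<in>UNIV. 1 / c j)"
    unfolding G_def using c
    by (intro mult_right_mono weighted_Cauchy_Schwarz(2)[OF lam meas int] prod_nonneg) (simp add: less_imp_le)
  also have "\<dots> = sqrt (LINT x:cube|lebesgue. \<bar>g x\<bar>\<^sup>2 * mweight lam p x) *
    (\<Prod>j\<in>UNIV. sqrt (gegenbauer_norm (lam + real (p j)) (k j - p j)) * (1 / c j))"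
    by (simp only: gegenbauer_norm_eq P_def prod.distrib mult.assoc)
  finally show ?thesis unfolding J_def c_inv .
qed

theorem theorem5p1:
  fixes lam :: real
    and m k :: "'n::finite \<Rightarrow> nat"
    and f :: "real ^ 'n \<Rightarrow> real"
  assumes "lam > 0"
    and "\<And>j. m j \<ge> 1"
    and "f \<in> mixed_space m"
  shows "ereal \<bar>gegenbauer_coeff lam f k\<bar> \<le>
    gegenbauer_V lam f k m / ereal (mgegenbauer_norm lam k) *
    ereal (\<Prod>j\<in>UNIV.
      sqrt (gegenbauer_norm (lam + real (min (k j) (m j))) (k j - min (k j) (m j))) *
      (\<Prod>s<min (k j) (m j).
         2 * (lam + real s) / ((real (k j) - real s) * (real (k j) + 2 * lam + real s))))"
proof -
  define p where "p = multi_min k m"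
  define g where "g = distr_deriv p f"
  define N where "N = mgegenbauer_norm lam k"
  define W where "W = (\<Prod>j\<in>UNIV. sqrt (gegenbauer_norm (lam + real (p j)) (k j - p j)) *
      (\<Prod>s<p j. 2 * (lam + real s) / ((real (k j) - real s) * (real (k j) + 2 * lam + real s))))"
  have N: "N > 0" using assms(1) by (auto simp: N_def mgegenbauer_norm_def intro!: prod_pos gegenbauer_norm_pos)
  have pk: "p \<le> k" by (simp add: p_def multi_min_def le_fun_def)
  \<comment> \<open>Strict positivity matters for the case of infinite \<open>V\<close>: in
    \<open>ereal\<close> the product of \<open>\<infinity>\<close> and \<open>0\<close> is
    \<open>0\<close>.\<close>
  have W: "W > 0"
    unfolding W_def
  proof (intro prod_pos ballI mult_pos_pos divide_pos_pos)
    show "sqrt (gegenbauer_norm (lam + real (p j)) (k j - p j)) > 0" for j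
      using assms(1) by (simp add: gegenbauer_norm_pos)
    show "real (k j) - real s > 0" if "s \<in> {..<p j}" for j s
      using that le_funD[OF pk, of j] by simp
  qed (use assms(1) in auto)
  have cont: "continuous_on cube f" using assms(3) by (simp add: mixed_space_def)
  have "ereal \<bar>gegenbauer_coeff lam f k\<bar> \<le> gegenbauer_V lam f k m / ereal N * ereal W"
  \<comment> \<open>The two cases mirror the definition of \<open>gegenbauer_V\<close>. When
    \<open>V\<close> is infinite, so is the right-hand side.\<close>
  proof (cases "(\<exists>g. has_distr_deriv f p g) \<and> set_integrable lebesgue cube (\<lambda>x. \<bar>g x\<bar>\<^sup>2 * mweight lam p x)")
    case True
    \<comment> \<open>\<open>distr_deriv\<close> is a choice among the representing functions, and
      existence makes the chosen one a representative.\<close>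
    have der: "has_distr_deriv f p g"
      unfolding g_def distr_deriv_def by (rule someI_ex[OF conjunct1[OF True]])
    let ?V = "sqrt (LINT x:cube|lebesgue. \<bar>g x\<bar>\<^sup>2 * mweight lam p x)"
    have V: "gegenbauer_V lam f k m = ereal ?V"
      using True by (simp add: gegenbauer_V_def Let_def g_def p_def)
    have "\<bar>gegenbauer_coeff lam f k\<bar> \<le> ?V * W / N"
      using gegenbauer_coeff_bound[OF assms(1) pk cont der conjunct2[OF True]] N
      unfolding gegenbauer_coeff_def N_def[symmetric] W_def
      by (simp add: abs_mult divide_right_mono)
    then show ?thesis using N unfolding V by simp
  next
    case False
    then have "gegenbauer_V lam f k m = \<infinity>"
      unfolding gegenbauer_V_def Let_def g_def p_def by (simp only: if_False)
    then show ?thesis using N W by simp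
  qed
  then show ?thesis by (simp only: W_def N_def p_def multi_min_def)
qed

end
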